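(* (i) For every real $q$ with $0<q<1$, $$\frac{(q^{2/3};q)_\infty^2\,(q^{7/6};q)_\infty}{(q;q)_\infty^2\,(q^{1/2};q)_\infty} =\sum_{n=0}^{\infty}(-1)^{n}\frac{(q^{1/6};q^{1/2})_n^2\,(q^{5/6};q^{1/2})_n\,(q^{-1/3},q^{5/6};q)_n}{(q;q)_n^2\,(q^{1/2};q^{1/2})_{3n}}\,q^{\frac{n(9n+11)}{12}}$$ $$\times\left\{1+q^{\frac16-n}\,\frac{(1-q^{\frac32n})(1-q^{2n-\frac16})}{(1-q^{\frac n2+\frac13})(1-q^{n-\frac16})}\right\}.$$ (ii) The limiting case $q\to1$ gives $$\frac{3\sqrt3}{\pi\sqrt[3]{4}}=\sum_{n=0}^{\infty}\left(\frac{-1}{27}\right)^n\frac{(\frac13)_n(-\frac13)_n(-\frac16)_n}{(1)_n^3}\,(1-63n^2).$$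
   Context: For a base $p$: $(x;p)_0=1$, $(x;p)_n=\prod_{j=0}^{n-1}(1-p^jx)$, $(x;p)_\infty=\prod_{j\ge0}(1-p^jx)$, and $(x_1,\dots,x_r;p)_n=(x_1;p)_n\cdots(x_r;p)_n$. Fractional powers of $q$ are the positive real ones. $(x)_0=1$ and $(x)_n=x(x+1)\cdots(x+n-1)$ is the ordinary shifted factorial. *)

theory Defs
  imports "HOL-Analysis.Analysis"
begin

definition qpoch :: "real \<Rightarrow> real \<Rightarrow> nat \<Rightarrow> real" where
  "qpoch x p n = (\<Prod>j<n. 1 - p ^ j * x)"

text \<open>The infinite product converges for every \<open>x\<close> when \<open>\<bar>p\<bar> < 1\<close>, also if a factor vanishes;
  for other \<open>p\<close> the value is not meaningful.\<close>

definition qpoch_inf :: "real \<Rightarrow> real \<Rightarrow> real" where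
  "qpoch_inf x p = prodinf (\<lambda>j. 1 - p ^ j * x)"

end

theory Submission
  imports Defs
begin

text \<open>The number \<open>x\<close> and \<open>q\<^sup>-\<^sup>x\<^sup>/\<^sup>2 - q\<^sup>x\<^sup>/\<^sup>2\<close> obey the same three-term relation, so both series are treated at
  once for a function \<open>s\<close> with that relation. The well-poised series \<open>\<Omega>(a; b, c, d, e)\<close> satisfies two
  inhomogeneous contiguous relations coming from telescoping. Applying them alternately, which shifts
  \<open>(a; b, c, d, e)\<close> to \<open>(a + 2; b + 1, c + 1, d, e + 1)\<close>, expands \<open>\<Omega>(-1/6; -1/6, -1/6, 1/3, -1/6)\<close> into the
  rapidly convergent series. The same value is an infinite product, because with \<open>e = a\<close> the first relation
  becomes homogeneous and can be iterated in \<open>a\<close>. For \<open>s x = x\<close> the product is evaluated by the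
  Gamma function.\<close>

text \<open>For \<open>s x = x\<close> the terms of the initial series decay only like k^(-8/3),
  while the ratio of the factors accumulated by the iteration tends to -1/27. The main obstacle is
  convergence: for the q-series the brackets \<open>s x\<close> grow exponentially, so polynomial
  asymptotics are of no use. Every estimate is therefore an inequality between brackets:
  \<open>ratio_le\<close> says that s x / x increases, and \<open>mult_le\<close> trades two
  brackets for the one at the sum, at the price of a linear factor. Because a = -1/6 is negative,
  the initial series has nonpositive terms, while all later series of both iterations have
  nonnegative ones. Hence index 0 and indices from 1 on are separate cases throughout. Part (ii) is
  proved directly from \<open>s x = x\<close>, not by letting q tend to 1, so no limit is
  interchanged with a sum.\<close>

text \<open>The two instances are \<open>s x = x\<close> for the classical series and
  \<open>s x = q\<^sup>-\<^sup>x\<^sup>/\<^sup>2 - q\<^sup>x\<^sup>/\<^sup>2\<close> for the \<open>q\<close>-series; in terms of the latter all explicit powers of \<open>q\<close> disappear.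
  The two inequalities hold for both and give every estimate uniformly.\<close>

locale bracket =
  fixes s :: "real \<Rightarrow> real" and K :: real
  assumes mult_diff: "s (x + y) * s (x - y) = (s x)\<^sup>2 - (s y)\<^sup>2"
    and pos: "0 < x \<Longrightarrow> 0 < s x"
    and ratio_le: "0 < x \<Longrightarrow> x \<le> y \<Longrightarrow> s x * y \<le> x * s y"
    and mult_le: "0 < x \<Longrightarrow> 0 < y \<Longrightarrow> s x * s y \<le> K * y * s (x + y)"
begin

section \<open>Algebra and signs of brackets\<close>

lemma zero [simp]: "s 0 = 0"
  using mult_diff[of 0 0] by simp

lemma minus [simp]: "s (- x) = - s x"
proof -
  \<comment> \<open>The two instances interchange half-sum and half-difference, which changes the
    sign of the difference of squares.\<close>
  have "s 1 * s x = - (s 1 * s (- x))"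
    using mult_diff[of "(1 + x) / 2" "(1 - x) / 2"] mult_diff[of "(1 - x) / 2" "(1 + x) / 2"]
    by (simp add: field_simps)
  hence "s 1 * (s x + s (- x)) = 0"
    by (simp add: algebra_simps)
  with pos[of 1] show ?thesis by simp
qed

lemma neg: "x < 0 \<Longrightarrow> s x < 0"
  using pos[of "- x"] by simp

lemma eq_0_iff [simp]: "s x = 0 \<longleftrightarrow> x = 0"
  using pos[of x] neg[of x] by (cases x "0 :: real" rule: linorder_cases) auto

lemma pos_iff [simp]: "0 < s x \<longleftrightarrow> 0 < x"
  using pos[of x] neg[of x] by (cases x "0 :: real" rule: linorder_cases) auto

lemma nonneg_iff [simp]: "0 \<le> s x \<longleftrightarrow> 0 \<le> x"
  using pos_iff[of x] eq_0_iff[of x] by linarith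

text \<open>Each product is a difference of squares at the half-sum and half-difference; equal sums
  make the half-sum squares cancel.\<close>

lemma three_term:
  assumes "t + u = v + w"
  shows "s v * s w - s t * s u = s (t - v) * s (t - w)"
proof -
  have *: "s p * s q = (s ((p + q) / 2))\<^sup>2 - (s ((p - q) / 2))\<^sup>2" for p q
    using mult_diff[of "(p + q) / 2" "(p - q) / 2"] by (simp add: field_simps)
  have h: "(t - v + (t - w)) / 2 = (t - u) / 2" "(t - v - (t - w)) / 2 = - ((v - w) / 2)"
    using assms by (auto simp: field_simps)
  show ?thesis
    unfolding *[of v w] *[of t u] *[of "t - v"] h assms by simp
qed

text \<open>Suitably paired, all the products are differences of four squares \<open>p\<close>,
  \<open>q\<close>, \<open>r\<close>, \<open>t\<close>, and the claim becomes a polynomial identity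
  in these.\<close>

lemma weierstrass:
  "s z * s (z - b - c) * s (z - b - d) * s (z - c - d) =
     s b * s c * s d * s (2 * z - b - c - d) + s (z - b - c - d) * s (z - b) * s (z - c) * s (z - d)"
proof -
  have *: "s p * s q = (s ((p + q) / 2))\<^sup>2 - (s ((p - q) / 2))\<^sup>2" for p q
    using mult_diff[of "(p + q) / 2" "(p - q) / 2"] by (simp add: field_simps)
  define p q r t where "p = (s (z - (b + c) / 2))\<^sup>2" and "q = (s ((b + c) / 2))\<^sup>2"
    and "r = (s (z - d - (b + c) / 2))\<^sup>2" and "t = (s ((b - c) / 2))\<^sup>2"
  have h: "s z * s (z - b - c) = p - q" "s b * s c = q - t" "s (z - b - d) * s (z - c - d) = r - t"
    "s d * s (2 * z - b - c - d) = p - r" "s (z - b - c - d) * s (z - d) = r - q"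
    "s (z - b) * s (z - c) = p - t"
    unfolding p_def q_def r_def t_def
    using minus[of "(b - c) / 2"] minus[of "(b + c) / 2"] minus[of "z - d - (b + c) / 2"]
    by (subst *, simp add: field_simps minus_divide_left del: minus)+
  have "(p - q) * (r - t) = (q - t) * (p - r) + (r - q) * (p - t)"
    by (simp add: algebra_simps)
  thus ?thesis
    unfolding h[symmetric] by (simp add: mult_ac)
qed

lemma mono: "0 \<le> x \<Longrightarrow> x \<le> y \<Longrightarrow> s x \<le> s y"
proof (cases "x = 0")
  case False
  assume "0 \<le> x" "x \<le> y"
  with False have "s x * y \<le> x * s y" "0 < x"
    using ratio_le[of x y] by auto
  moreover have "x * s y \<le> y * s y"
    using \<open>0 \<le> x\<close> \<open>x \<le> y\<close> by (intro mult_right_mono) auto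
  ultimately have "y * s x \<le> y * s y"
    by (simp add: mult.commute)
  thus ?thesis using \<open>0 < x\<close> \<open>x \<le> y\<close> by simp
qed auto

lemma abs_s: "\<bar>s x\<bar> = s \<bar>x\<bar>"
  using pos[of x] neg[of x] by (cases x "0 :: real" rule: linorder_cases) auto

section \<open>Shifted factorials and the two telescoping relations\<close>

text \<open>The ordinary shifted factorial for \<open>s x = x\<close>; for the q-instance it is
  (q^x; q)_n up to a power of q.\<close>

definition P :: "real \<Rightarrow> nat \<Rightarrow> real" where
  "P x n = (\<Prod>j<n. s (x + real j))"

definition Q :: "real \<Rightarrow> real \<Rightarrow> nat \<Rightarrow> real" where
  "Q x y n = P x n / P y n"

lemma Q_0 [simp]: "Q x y 0 = 1"
  by (simp add: Q_def P_def)

lemma P_Suc: "P x (Suc n) = P x n * s (x + real n)"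
  by (simp add: P_def)

lemma P_Suc': "P x (Suc n) = s x * P (x + 1) n"
  unfolding P_def by (subst prod.lessThan_Suc_shift) (simp add: add_ac)

lemma P_pos: "0 < x \<Longrightarrow> 0 < P x n"
  unfolding P_def by (intro prod_pos) auto

lemma Q_pos: "0 < x \<Longrightarrow> 0 < y \<Longrightarrow> 0 < Q x y n"
  by (simp add: Q_def P_pos)

lemma Q_Suc: "Q x y (Suc n) = Q x y n * s (x + real n) / s (y + real n)"
  by (simp add: Q_def P_Suc)

lemma Q_numerator_plus1: "s x * Q (x + 1) y n = Q x y n * s (x + real n)"
  using P_Suc[of x n] P_Suc'[of x n] by (simp add: Q_def)

lemma Q_denominator_plus1:
  assumes "0 < y"
  shows "Q x (y + 1) n = Q x y n * s y / s (y + real n)"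
proof -
  have "P (y + 1) n = P y n * s (y + real n) / s y"
    using P_Suc[of y n] P_Suc'[of y n] assms by (simp add: field_simps)
  thus ?thesis by (simp add: Q_def)
qed

text \<open>The terms of the well-poised series \<open>\<Omega>(a; b, c, d, e)\<close> of Chu; it is Dougall's
  summable \<open>\<^sub>5F\<^sub>4\<close> (respectively \<open>\<^sub>6\<phi>\<^sub>5\<close>) series when \<open>e = a\<close>.\<close>

definition T :: "real \<Rightarrow> real \<Rightarrow> real \<Rightarrow> real \<Rightarrow> real \<Rightarrow> nat \<Rightarrow> real" where
  "T a b c d e k = s (a + 2 * real k) *
     (Q b (1 + a - b) k * Q c (1 + a - c) k * Q d (1 + a - d) k * Q e (1 + a - e) k)"

lemma T_0 [simp]: "T a b c d e 0 = s a"
  by (simp add: T_def)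

text \<open>The antidifference in both relations: the term with its factor
  \<open>s (a + 2 * real k)\<close> exchanged for two brackets. Taking \<open>a - e\<close> (or
  \<open>a - c\<close>) for one of them cancels, at \<open>Suc k\<close>, the new denominator of the
  corresponding quotient.\<close>

definition G :: "real \<Rightarrow> real \<Rightarrow> real \<Rightarrow> real \<Rightarrow> real \<Rightarrow> real \<Rightarrow> real \<Rightarrow> real \<Rightarrow> nat \<Rightarrow> real" where
  "G a b c d e u v w k = - T a b c d e k * s (u + real k) * s (v + real k) / (s (a + 2 * real k) * s w)"

text \<open>After division by the common factor \<open>V\<close> this combines one instance of
  \<open>weierstrass\<close> with one of \<open>three_term\<close>; the terms containing
  \<open>s (a - \<mu> + \<kappa>)\<close> cancel.\<close>

lemma telescope_one:
  assumes "0 < 1 + a - b" "0 < 1 + a - c" "0 < 1 + a - d" "0 < 1 + a - e"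
    and "\<And>k. a + 2 * real k \<noteq> 0" and "\<mu> = 2 * a + 1 - b - c - d" and "\<mu> \<noteq> e"
  shows "T a b c d e k =
      s e * s (1 + a - b - c) * s (1 + a - b - d) * s (1 + a - c - d) /
        (s (\<mu> - e) * s (1 + a - b) * s (1 + a - c) * s (1 + a - d)) * T (a + 1) b c d (e + 1) k
      + (G a b c d e (a - e) \<mu> (\<mu> - e) (Suc k) - G a b c d e (a - e) \<mu> (\<mu> - e) k)"
proof -
  define \<kappa> where "\<kappa> = real k"
  define V where "V = Q b (1 + a - b) k * Q c (1 + a - c) k * Q d (1 + a - d) k * Q e (1 + a - e) k"
  define w where "w = s (\<mu> - e)"
  define B C D where "B = s (1 + a - b + \<kappa>)" and "C = s (1 + a - c + \<kappa>)" and "D = s (1 + a - d + \<kappa>)"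
  have nz: "w \<noteq> 0" "B \<noteq> 0" "C \<noteq> 0" "D \<noteq> 0" "s (1 + a - e + \<kappa>) \<noteq> 0" "s (a + 2 * \<kappa>) \<noteq> 0"
    "s (a + 2 + 2 * \<kappa>) \<noteq> 0"
    using assms(1-4) assms(5)[of k] assms(5)[of "Suc k"] assms(7)
    unfolding w_def B_def C_def D_def \<kappa>_def by (auto simp: algebra_simps)
  have nz': "s (1 + a - b) \<noteq> 0" "s (1 + a - c) \<noteq> 0" "s (1 + a - d) \<noteq> 0"
    using assms by auto
  have g0: "G a b c d e (a - e) \<mu> (\<mu> - e) k = - V * s (a - e + \<kappa>) * s (\<mu> + \<kappa>) / w"
    using nz by (simp add: G_def T_def V_def w_def \<kappa>_def)
  have "G a b c d e (a - e) \<mu> (\<mu> - e) (Suc k) =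
     - (Q b (1 + a - b) (Suc k) * Q c (1 + a - c) (Suc k) * Q d (1 + a - d) (Suc k) * Q e (1 + a - e) (Suc k))
        * s (1 + a - e + \<kappa>) * s (\<mu> + 1 + \<kappa>) / w"
    using nz(7) by (simp add: G_def T_def w_def \<kappa>_def algebra_simps)
  also have "\<dots> = - V * (s (b + \<kappa>) * s (c + \<kappa>) * s (d + \<kappa>) * s (e + \<kappa>) * s (\<mu> + 1 + \<kappa>)) / (w * B * C * D)"
    using nz unfolding V_def B_def C_def D_def \<kappa>_def Q_Suc by (simp add: mult_ac)
  finally have g1: "G a b c d e (a - e) \<mu> (\<mu> - e) (Suc k) = \<dots>" .
  have "s e * T (a + 1) b c d (e + 1) k = s (a + 1 + 2 * \<kappa>) * (Q b (1 + a - b + 1) k * Q c (1 + a - c + 1) k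
     * Q d (1 + a - d + 1) k * (s e * Q (e + 1) (1 + a - e) k))"
    by (simp add: T_def \<kappa>_def algebra_simps)
  also have "\<dots> = s (1 + a - b) * s (1 + a - c) * s (1 + a - d) * V * s (a + 1 + 2 * \<kappa>) * s (e + \<kappa>) / (B * C * D)"
    unfolding Q_denominator_plus1[OF assms(1)] Q_denominator_plus1[OF assms(2)] Q_denominator_plus1[OF assms(3)]
      Q_numerator_plus1 V_def B_def C_def D_def \<kappa>_def by simp
  finally have t1: "s e * T (a + 1) b c d (e + 1) k = \<dots>" .
  define E where "E = s (1 + a - b - c) * s (1 + a - b - d) * s (1 + a - c - d)"
  have "s e * s (1 + a - b - c) * s (1 + a - b - d) * s (1 + a - c - d) /
        (s (\<mu> - e) * s (1 + a - b) * s (1 + a - c) * s (1 + a - d)) * T (a + 1) b c d (e + 1) k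
     = E / (w * (s (1 + a - b) * s (1 + a - c) * s (1 + a - d))) * (s e * T (a + 1) b c d (e + 1) k)"
    unfolding E_def w_def by (simp add: mult_ac)
  also have "\<dots> = V * E * s (a + 1 + 2 * \<kappa>) * s (e + \<kappa>) / (w * B * C * D)"
    unfolding t1 using nz nz' by (simp add: field_simps)
  finally have t2: "s e * s (1 + a - b - c) * s (1 + a - b - d) * s (1 + a - c - d) /
        (s (\<mu> - e) * s (1 + a - b) * s (1 + a - c) * s (1 + a - d)) * T (a + 1) b c d (e + 1) k = \<dots>" .
  \<comment> \<open>This dictates \<mu>: twice the first argument minus the other three is
    \<open>\<mu> + 1 + \<kappa>\<close>, the bracket in \<open>G\<close> at
    \<open>Suc k\<close>.\<close>
  have W: "s (a + 1 + 2 * \<kappa>) * E = s (b + \<kappa>) * s (c + \<kappa>) * s (d + \<kappa>) * s (\<mu> + 1 + \<kappa>) + s (a - \<mu> + \<kappa>) * (- B * C * D)"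
    using weierstrass[of "a + 1 + 2 * \<kappa>" "b + \<kappa>" "c + \<kappa>" "d + \<kappa>"] minus[of "a - \<mu> + \<kappa>"]
    unfolding E_def B_def C_def D_def assms(6) by (simp add: algebra_simps)
  have X: "s (a + 2 * \<kappa>) * w = s (a - e + \<kappa>) * s (\<mu> + \<kappa>) - s (a - \<mu> + \<kappa>) * s (e + \<kappa>)"
    using three_term[of "a + 2 * \<kappa>" "\<mu> - e" "a - e + \<kappa>" "\<mu> + \<kappa>"] unfolding w_def by (simp add: algebra_simps)
  have "(s (a + 2 * \<kappa>) * w) * (B * C * D) =
      (s (a + 1 + 2 * \<kappa>) * E) * s (e + \<kappa>)
       - s (b + \<kappa>) * s (c + \<kappa>) * s (d + \<kappa>) * s (e + \<kappa>) * s (\<mu> + 1 + \<kappa>)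
       + s (a - e + \<kappa>) * s (\<mu> + \<kappa>) * (B * C * D)"
    unfolding X W by (simp add: algebra_simps)
  hence "V * s (a + 2 * \<kappa>) = V * E * s (a + 1 + 2 * \<kappa>) * s (e + \<kappa>) / (w * B * C * D)
      - V * (s (b + \<kappa>) * s (c + \<kappa>) * s (d + \<kappa>) * s (e + \<kappa>) * s (\<mu> + 1 + \<kappa>)) / (w * B * C * D)
      + V * s (a - e + \<kappa>) * s (\<mu> + \<kappa>) / w"
    using nz by (simp add: divide_simps) algebra
  thus ?thesis
    unfolding g0 g1 t2 by (simp add: T_def V_def \<kappa>_def algebra_simps)
qed

text \<open>Raising \<open>c\<close> along with \<open>e\<close> changes only two denominators, so
  \<open>three_term\<close> suffices where \<open>telescope_one\<close> needs
  \<open>weierstrass\<close>.\<close>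

lemma telescope_two:
  assumes "0 < 1 + a - b" "0 < 1 + a - c" "0 < 1 + a - d" "0 < 1 + a - e"
    and "\<And>k. a + 2 * real k \<noteq> 0" and "a \<noteq> c + e"
  shows "T a b c d e k =
      - s (1 + a - b - d) * s c * s e / (s (a - c - e) * s (1 + a - b) * s (1 + a - d))
         * T (a + 1) b (c + 1) d (e + 1) k
      + (G a b c d e (a - c) (a - e) (a - c - e) (Suc k) - G a b c d e (a - c) (a - e) (a - c - e) k)"
proof -
  define \<kappa> where "\<kappa> = real k"
  define V where "V = Q b (1 + a - b) k * Q c (1 + a - c) k * Q d (1 + a - d) k * Q e (1 + a - e) k"
  define w where "w = s (a - c - e)"
  define B D where "B = s (1 + a - b + \<kappa>)" and "D = s (1 + a - d + \<kappa>)"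
  have nz: "w \<noteq> 0" "B \<noteq> 0" "s (1 + a - c + \<kappa>) \<noteq> 0" "D \<noteq> 0" "s (1 + a - e + \<kappa>) \<noteq> 0" "s (a + 2 * \<kappa>) \<noteq> 0"
    "s (a + 2 + 2 * \<kappa>) \<noteq> 0"
    using assms(1-4) assms(5)[of k] assms(5)[of "Suc k"] assms(6)
    unfolding w_def B_def D_def \<kappa>_def by (auto simp: algebra_simps)
  have nz': "s (1 + a - b) \<noteq> 0" "s (1 + a - d) \<noteq> 0"
    using assms by auto
  have g0: "G a b c d e (a - c) (a - e) (a - c - e) k = - V * s (a - c + \<kappa>) * s (a - e + \<kappa>) / w"
    using nz by (simp add: G_def T_def V_def w_def \<kappa>_def)
  have "G a b c d e (a - c) (a - e) (a - c - e) (Suc k) =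
     - (Q b (1 + a - b) (Suc k) * Q c (1 + a - c) (Suc k) * Q d (1 + a - d) (Suc k) * Q e (1 + a - e) (Suc k))
        * s (1 + a - c + \<kappa>) * s (1 + a - e + \<kappa>) / w"
    using nz(7) by (simp add: G_def T_def w_def \<kappa>_def algebra_simps)
  also have "\<dots> = - V * (s (b + \<kappa>) * s (c + \<kappa>) * s (d + \<kappa>) * s (e + \<kappa>)) / (w * B * D)"
    using nz unfolding V_def B_def D_def \<kappa>_def Q_Suc by (simp add: mult_ac)
  finally have g1: "G a b c d e (a - c) (a - e) (a - c - e) (Suc k) = \<dots>" .
  have "s c * s e * T (a + 1) b (c + 1) d (e + 1) k = s (a + 1 + 2 * \<kappa>) * (Q b (1 + a - b + 1) k
     * (s c * Q (c + 1) (1 + a - c) k) * Q d (1 + a - d + 1) k * (s e * Q (e + 1) (1 + a - e) k))"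
    by (simp add: T_def \<kappa>_def algebra_simps)
  also have "\<dots> = s (1 + a - b) * s (1 + a - d) * V * s (a + 1 + 2 * \<kappa>) * s (c + \<kappa>) * s (e + \<kappa>) / (B * D)"
    unfolding Q_denominator_plus1[OF assms(1)] Q_denominator_plus1[OF assms(3)]
      Q_numerator_plus1 V_def B_def D_def \<kappa>_def by simp
  finally have t1: "s c * s e * T (a + 1) b (c + 1) d (e + 1) k = \<dots>" .
  define E where "E = s (1 + a - b - d)"
  have "- s (1 + a - b - d) * s c * s e / (s (a - c - e) * s (1 + a - b) * s (1 + a - d))
         * T (a + 1) b (c + 1) d (e + 1) k
     = - E / (w * (s (1 + a - b) * s (1 + a - d))) * (s c * s e * T (a + 1) b (c + 1) d (e + 1) k)"
    unfolding E_def w_def by (simp add: mult_ac)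
  also have "\<dots> = - V * E * s (a + 1 + 2 * \<kappa>) * s (c + \<kappa>) * s (e + \<kappa>) / (w * B * D)"
    unfolding t1 using nz nz' by (simp add: field_simps)
  finally have t2: "- s (1 + a - b - d) * s c * s e / (s (a - c - e) * s (1 + a - b) * s (1 + a - d))
         * T (a + 1) b (c + 1) d (e + 1) k = \<dots>" .
  have W: "E * s (a + 1 + 2 * \<kappa>) = B * D - s (b + \<kappa>) * s (d + \<kappa>)"
    using three_term[of "a + 1 + 2 * \<kappa>" "1 + a - b - d" "1 + a - b + \<kappa>" "1 + a - d + \<kappa>"]
    unfolding E_def B_def D_def by (simp add: algebra_simps)
  have X: "s (a + 2 * \<kappa>) * w = s (a - c + \<kappa>) * s (a - e + \<kappa>) - s (c + \<kappa>) * s (e + \<kappa>)"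
    using three_term[of "a + 2 * \<kappa>" "a - c - e" "a - c + \<kappa>" "a - e + \<kappa>"] unfolding w_def by (simp add: algebra_simps)
  have "(s (a + 2 * \<kappa>) * w) * (B * D) =
      - (E * s (a + 1 + 2 * \<kappa>)) * s (c + \<kappa>) * s (e + \<kappa>)
       - s (b + \<kappa>) * s (c + \<kappa>) * s (d + \<kappa>) * s (e + \<kappa>)
       + s (a - c + \<kappa>) * s (a - e + \<kappa>) * (B * D)"
    unfolding X W by (simp add: algebra_simps)
  hence "V * s (a + 2 * \<kappa>) = - V * E * s (a + 1 + 2 * \<kappa>) * s (c + \<kappa>) * s (e + \<kappa>) / (w * B * D)
      - V * (s (b + \<kappa>) * s (c + \<kappa>) * s (d + \<kappa>) * s (e + \<kappa>)) / (w * B * D)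
      + V * s (a - c + \<kappa>) * s (a - e + \<kappa>) / w"
    using nz by (simp add: divide_simps) algebra
  thus ?thesis
    unfolding g0 g1 t2 by (simp add: T_def V_def \<kappa>_def algebra_simps)
qed

section \<open>Growth estimates and vanishing boundary terms\<close>

lemma K_pos: "0 < K"
proof -
  have "s 1 * s 1 \<le> K * 1 * s (1 + 1)" by (rule mult_le) auto
  moreover have "0 < s 1 * s 1" by (intro mult_pos_pos pos) auto
  ultimately have "0 < K * s 2" by (simp del: pos_iff)
  thus ?thesis by (rule zero_less_mult_pos2) (simp add: pos)
qed

text \<open>The ratio s (x + w) / s x decreases in x, so a fixed offset in the argument costs only a
  constant factor.\<close>

lemma shift_le:
  assumes "0 < u" "u \<le> x" "0 \<le> w"
  shows "s (x + w) * s u \<le> s x * s (u + w)"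
proof -
  have "s x * s (u + w) - s (x + w) * s u = s w * s (x - u)"
    using three_term[of "x + w" u x "u + w"] by simp
  also have "\<dots> \<ge> 0" using assms by simp
  finally show ?thesis by simp
qed

lemma mult_le_double:
  obtains C where "0 < C"
    "\<And>k::nat. 0 < u + real k \<Longrightarrow> 0 < v + real k \<Longrightarrow> 1 \<le> a + 2 * real k \<Longrightarrow>
       s (u + real k) * s (v + real k) \<le> C * (real k + 1) * s (a + 2 * real k)"
proof
  define w where "w = \<bar>u + v - a\<bar>"
  \<comment> \<open>\<open>K\<close> and the linear factor come from \<open>mult_le\<close>;
    \<open>s (1 + w) / s 1\<close> pays for replacing u + v by a.\<close>
  define C where "C = K * (\<bar>v\<bar> + 1) * s (1 + w) / s 1"
  have w: "0 \<le> w" "u + v \<le> a + w" unfolding w_def by auto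
  show "0 < C" unfolding C_def using K_pos w by (intro divide_pos_pos mult_pos_pos) auto
  fix k :: nat
  assume k: "0 < u + real k" "0 < v + real k" "1 \<le> a + 2 * real k"
  have "v + real k \<le> (\<bar>v\<bar> + 1) * (real k + 1)"
  proof -
    have "v + real k \<le> \<bar>v\<bar> + real k" by simp
    also have "\<dots> \<le> \<bar>v\<bar> * real k + \<bar>v\<bar> + real k + 1" by simp
    finally show ?thesis by (simp add: algebra_simps)
  qed
  moreover have "s (u + v + 2 * real k) \<le> s (a + 2 * real k + w)"
    using k w by (intro mono) auto
  moreover have "s (a + 2 * real k + w) \<le> s (a + 2 * real k) * (s (1 + w) / s 1)"
    using shift_le[of 1 "a + 2 * real k" w] k w by (simp add: field_simps)
  ultimately have "(v + real k) * s (u + v + 2 * real k) \<le>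
      (\<bar>v\<bar> + 1) * (real k + 1) * (s (a + 2 * real k) * (s (1 + w) / s 1))"
    using k w by (intro mult_mono) auto
  hence "K * ((v + real k) * s (u + v + 2 * real k)) \<le>
      K * ((\<bar>v\<bar> + 1) * (real k + 1) * (s (a + 2 * real k) * (s (1 + w) / s 1)))"
    using K_pos by (intro mult_left_mono) auto
  moreover have "s (u + real k) * s (v + real k) \<le> K * (v + real k) * s (u + v + 2 * real k)"
    using mult_le[OF k(1,2)] by (simp add: algebra_simps)
  ultimately show "s (u + real k) * s (v + real k) \<le> C * (real k + 1) * s (a + 2 * real k)"
    by (simp add: C_def algebra_simps)
qed

text \<open>A nonzero limit of \<open>G\<close> would make the terms of the summable series \<open>T\<close> at least of order \<open>1 / k\<close>.\<close>

lemma G_limit_0: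
  assumes "summable (\<lambda>k. \<bar>T a b c d e k\<bar>)" "w \<noteq> 0"
    and L: "G a b c d e u v w \<longlonglongrightarrow> L"
  shows "L = 0"
proof (rule ccontr)
  assume "L \<noteq> 0"
  obtain C where C: "0 < C" "\<And>k::nat. 0 < u + real k \<Longrightarrow> 0 < v + real k \<Longrightarrow> 1 \<le> a + 2 * real k \<Longrightarrow>
       s (u + real k) * s (v + real k) \<le> C * (real k + 1) * s (a + 2 * real k)"
    using mult_le_double[of u v a] by blast
  \<comment> \<open>Chosen so that \<open>\<bar>G\<bar> > \<bar>L\<bar> / 2\<close> forces
    \<open>\<bar>T\<bar> \<ge> \<delta> / (k + 1)\<close>.\<close>
  define \<delta> where "\<delta> = \<bar>L\<bar> / 2 * \<bar>s w\<bar> / C"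
  have \<delta>: "0 < \<delta>" unfolding \<delta>_def using \<open>L \<noteq> 0\<close> C assms(2) by auto
  have "(\<lambda>k. \<bar>G a b c d e u v w k\<bar>) \<longlonglongrightarrow> \<bar>L\<bar>"
    by (intro tendsto_intros L)
  hence ev: "eventually (\<lambda>k. \<bar>G a b c d e u v w k\<bar> > \<bar>L\<bar> / 2) sequentially"
    using \<open>L \<noteq> 0\<close> by (intro order_tendstoD) auto
  have "eventually (\<lambda>k. norm (\<delta> * (1 / real (Suc k))) \<le> \<bar>T a b c d e k\<bar>) sequentially"
    using ev eventually_ge_at_top[of "nat \<lceil>\<bar>u\<bar> + \<bar>v\<bar> + \<bar>a\<bar> + 1\<rceil>"]
  proof eventually_elim
    case (elim k)
    hence "\<bar>u\<bar> + \<bar>v\<bar> + \<bar>a\<bar> + 1 \<le> real k" by linarith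
    hence k: "0 < u + real k" "0 < v + real k" "1 \<le> a + 2 * real k" by linarith+
    have "\<bar>G a b c d e u v w k\<bar> =
        \<bar>T a b c d e k\<bar> * (s (u + real k) * s (v + real k)) / (s (a + 2 * real k) * \<bar>s w\<bar>)"
      using k unfolding G_def by (simp add: abs_mult)
    also have "\<dots> \<le> \<bar>T a b c d e k\<bar> * (C * (real k + 1) * s (a + 2 * real k)) / (s (a + 2 * real k) * \<bar>s w\<bar>)"
      using C(2)[OF k] k by (intro divide_right_mono mult_left_mono) auto
    also have "\<dots> = \<bar>T a b c d e k\<bar> * (C * (real k + 1)) / \<bar>s w\<bar>"
      using k by simp
    finally have "\<bar>L\<bar> / 2 \<le> \<bar>T a b c d e k\<bar> * (C * (real k + 1)) / \<bar>s w\<bar>"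
      using elim by linarith
    hence "\<bar>L\<bar> / 2 * \<bar>s w\<bar> \<le> \<bar>T a b c d e k\<bar> * (C * (real k + 1))"
      using assms(2) by (simp add: pos_le_divide_eq)
    hence "\<delta> \<le> \<bar>T a b c d e k\<bar> * (real k + 1)"
      unfolding \<delta>_def using C(1) by (simp add: pos_divide_le_eq mult_ac)
    thus ?case using \<delta> by (simp add: field_simps)
  qed
  hence "summable (\<lambda>k. \<delta> * (1 / real (Suc k)))"
    by (rule summable_comparison_test_ev) (rule assms(1))
  hence "summable (\<lambda>k. 1 / real (Suc k))"
    using \<delta> by (subst (asm) summable_cmult_iff) auto
  thus False using not_summable_harmonic[where 'a = real] summable_Suc_iff[of "\<lambda>k. inverse (real k)"]
    by (simp add: inverse_eq_divide)
qed

text \<open>Summability of both series makes \<open>G\<close> converge, and \<open>G_limit_0\<close>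
  makes the limit 0. Only the boundary term at 0 remains.\<close>

lemma suminf_step:
  assumes eq: "\<And>k. T a b c d e k = \<rho> * t k + (G a b c d e u v w (Suc k) - G a b c d e u v w k)"
    and T: "summable (\<lambda>k. \<bar>T a b c d e k\<bar>)" and t: "summable t" and "w \<noteq> 0" "a \<noteq> 0"
  shows "suminf (T a b c d e) = s u * s v / s w + \<rho> * suminf t"
proof -
  let ?G = "G a b c d e u v w"
  have sT: "summable (T a b c d e)"
    using T by (rule summable_rabs_cancel)
  have "(\<lambda>k. T a b c d e k - \<rho> * t k) sums (suminf (T a b c d e) - \<rho> * suminf t)"
    by (intro sums_diff sums_mult summable_sums sT t)
  hence "(\<lambda>k. ?G (Suc k) - ?G k) sums (suminf (T a b c d e) - \<rho> * suminf t)"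
    unfolding eq by (simp cong: sums_cong)
  hence "(\<lambda>n. ?G n - ?G 0) \<longlonglongrightarrow> suminf (T a b c d e) - \<rho> * suminf t"
    by (simp add: sums_def sum_lessThan_telescope)
  from tendsto_add[OF this tendsto_const[of "?G 0"]]
  have "?G \<longlonglongrightarrow> suminf (T a b c d e) - \<rho> * suminf t + ?G 0" by simp
  from G_limit_0[OF T \<open>w \<noteq> 0\<close> this]
  have "suminf (T a b c d e) - \<rho> * suminf t + ?G 0 = 0" .
  moreover have "?G 0 = - (s u * s v / s w)"
    using \<open>a \<noteq> 0\<close> by (simp add: G_def)
  ultimately show ?thesis by simp
qed

text \<open>The coefficient of the shifted series in \<open>telescope_two\<close> is negative, and so is the boundary term at the
  upper end. Hence, for terms of constant sign, the lower boundary term alone bounds all partial sums;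
  this yields both the convergence and the estimates that make the remainders vanish. \<open>M\<close> allows for
  finitely many shifted terms of the wrong sign.\<close>

lemma telescope_two_bound:
  assumes "0 < 1 + a - b" "0 < 1 + a - c" "0 < 1 + a - d" "0 < 1 + a - e"
    and "- 2 < a" "a \<noteq> 0" "0 < a - c - e" "0 \<le> s c * s e" "0 \<le> 1 + a - b - d" "0 \<le> a - c" "0 \<le> a - e"
    and \<sigma>: "\<bar>\<sigma>\<bar> = 1" "\<And>k. 0 \<le> \<sigma> * T a b c d e k" "\<And>n. - M \<le> (\<Sum>k<n. \<sigma> * T (a + 1) b (c + 1) d (e + 1) k)"
  shows "summable (\<lambda>k. \<bar>T a b c d e k\<bar>)"
    and "\<sigma> * suminf (T a b c d e) \<le> \<sigma> * (s (a - c) * s (a - e) / s (a - c - e))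
          + s (1 + a - b - d) * (s c * s e) / (s (a - c - e) * s (1 + a - b) * s (1 + a - d)) * M"
proof -
  let ?G = "G a b c d e (a - c) (a - e) (a - c - e)"
  let ?B = "\<sigma> * (s (a - c) * s (a - e) / s (a - c - e))"
  define \<rho> where "\<rho> = s (1 + a - b - d) * (s c * s e) / (s (a - c - e) * s (1 + a - b) * s (1 + a - d))"
  have \<rho>: "0 \<le> \<rho>" unfolding \<rho>_def using assms
    by (intro divide_nonneg_pos mult_nonneg_nonneg[OF _ assms(8)] mult_pos_pos) auto
  have a: "a + 2 * real k \<noteq> 0" for k
    using assms(5,6) by (cases k) auto
  have eq: "\<sigma> * T a b c d e k = - \<rho> * (\<sigma> * T (a + 1) b (c + 1) d (e + 1) k) + (\<sigma> * ?G (Suc k) - \<sigma> * ?G k)" for k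
  proof -
    have "T a b c d e k = - \<rho> * T (a + 1) b (c + 1) d (e + 1) k + (?G (Suc k) - ?G k)"
      using telescope_two[OF assms(1-4) a, of k] assms(7) unfolding \<rho>_def by (simp add: mult_ac)
    thus ?thesis by (simp add: ring_distribs mult_ac)
  qed
  have G0: "\<sigma> * ?G 0 = - ?B"
    using \<open>a \<noteq> 0\<close> by (simp add: G_def)
  have G: "\<sigma> * ?G (Suc k) \<le> 0" for k
  proof -
    have "\<sigma> * ?G (Suc k) = - ((\<sigma> * T a b c d e (Suc k)) *
        (s (a - c + real (Suc k)) * s (a - e + real (Suc k)) / (s (a + 2 * real (Suc k)) * s (a - c - e))))"
      by (simp add: G_def)
    moreover have "0 \<le> s (a - c + real (Suc k)) * s (a - e + real (Suc k)) / (s (a + 2 * real (Suc k)) * s (a - c - e))"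
      using assms(5,7,10,11) by (intro divide_nonneg_nonneg mult_nonneg_nonneg) auto
    ultimately show ?thesis using \<sigma>(2)[of "Suc k"] by (metis mult_nonneg_nonneg neg_le_0_iff_le)
  qed
  have partial: "(\<Sum>k<n. \<sigma> * T a b c d e k) \<le> ?B + \<rho> * M" for n
  proof -
    \<comment> \<open>One term is added because the sign of \<open>G\<close> is known only at
      successors: a may be negative, but a + 2 is positive.\<close>
    have "(\<Sum>k<n. \<sigma> * T a b c d e k) \<le> (\<Sum>k<Suc n. \<sigma> * T a b c d e k)"
      using \<sigma>(2)[of n] by simp
    also have "\<dots> = - \<rho> * (\<Sum>k<Suc n. \<sigma> * T (a + 1) b (c + 1) d (e + 1) k) + (\<sigma> * ?G (Suc n) - \<sigma> * ?G 0)"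
      unfolding eq sum.distrib sum_distrib_left[symmetric]
      using sum_lessThan_telescope[of "\<lambda>k. \<sigma> * ?G k" "Suc n"] by simp
    also have "\<dots> \<le> \<rho> * M + (0 + ?B)"
      using G[of n] mult_left_mono[OF \<sigma>(3)[of "Suc n"] \<rho>]
      unfolding G0 by (intro add_mono) (simp_all del: sum.lessThan_Suc)
    finally show ?thesis by simp
  qed
  have summ: "summable (\<lambda>k. \<sigma> * T a b c d e k)"
    using \<sigma>(2) partial by (rule summableI_nonneg_bounded)
  have "\<bar>T a b c d e k\<bar> = \<sigma> * T a b c d e k" for k
    using \<sigma>(1) \<sigma>(2)[of k] by (metis abs_mult abs_of_nonneg mult_1)
  with summ show abs: "summable (\<lambda>k. \<bar>T a b c d e k\<bar>)" by simp
  have "(\<Sum>k. \<sigma> * T a b c d e k) \<le> ?B + \<rho> * M"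
    using summ partial by (rule suminf_le_const)
  thus "\<sigma> * suminf (T a b c d e) \<le> ?B + s (1 + a - b - d) * (s c * s e) / (s (a - c - e) * s (1 + a - b) * s (1 + a - d)) * M"
    unfolding \<rho>_def[symmetric]
    using suminf_mult[OF summable_rabs_cancel[OF abs], of \<sigma>] by simp
qed

section \<open>Signs of the terms and summability of the initial series\<close>

lemma P_nonpos: "-1 < x \<Longrightarrow> x < 0 \<Longrightarrow> P x (Suc k) \<le> 0"
  using P_pos[of "x + 1" k] neg[of x] unfolding P_Suc' by (simp add: mult_nonpos_nonneg)

lemma Q_Suc_nonpos:
  assumes "-1 < x" "x < 0" "0 < y"
  shows "Q x y (Suc k) \<le> 0"
  using P_nonpos[OF assms(1,2), of k] P_pos[OF assms(3), of "Suc k"]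
  by (auto simp: Q_def divide_nonpos_pos)

text \<open>The repeated parameter \<open>b\<close> contributes a square, so it may be
  negative.\<close>

lemma T_nonneg:
  assumes "0 < a" "0 < d" "0 < e" "0 < 1 + a - d" "0 < 1 + a - e"
  shows "0 \<le> T a d b e b k"
proof -
  have "0 < Q d (1 + a - d) k * Q e (1 + a - e) k" "0 < s (a + 2 * real k)"
    using assms by (auto intro!: mult_pos_pos Q_pos)
  hence "0 \<le> (s (a + 2 * real k) * (Q d (1 + a - d) k * Q e (1 + a - e) k)) * (Q b (1 + a - b) k)\<^sup>2"
    by (intro mult_nonneg_nonneg[OF mult_nonneg_nonneg]) (auto intro: less_imp_le)
  thus ?thesis unfolding T_def by (simp add: power2_eq_square mult_ac)
qed

text \<open>The telescoping relations, unlike \<open>T\<close>, are not symmetric in the last four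
  parameters.\<close>

lemma T_perm: "T a d b e c k = T a b c d e k" "T a b d c e k = T a b c d e k" "T a c d b e k = T a b c d e k"
  by (simp_all add: T_def mult_ac)

abbreviation T0 :: "nat \<Rightarrow> real" where "T0 \<equiv> T (-1/6) (1/3) (-1/6) (-1/6) (-1/6)"

text \<open>At k = 0 the sign is that of \<open>s (-1/6)\<close>; afterwards it comes from the third
  power of \<open>Q (-1/6) 1 k\<close>.\<close>

lemma T0_nonpos: "T0 k \<le> 0"
proof (cases k)
  case (Suc j)
  have "Q (-1/6) 1 k \<le> 0" unfolding Suc by (rule Q_Suc_nonpos) auto
  moreover have "0 < s (- 1/6 + 2 * real k) * Q (1/3) (1/2) k"
    using Suc by (intro mult_pos_pos Q_pos pos) auto
  ultimately have "(s (- 1/6 + 2 * real k) * Q (1/3) (1/2) k) * (Q (-1/6) 1 k)\<^sup>2 * Q (-1/6) 1 k \<le> 0"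
    by (intro mult_nonneg_nonpos mult_nonneg_nonneg[OF less_imp_le]) auto
  thus ?thesis by (simp add: T_def power2_eq_square mult_ac)
qed (auto intro: less_imp_le)

text \<open>The shifted series starts with \<open>s (5/6)\<close>, of the wrong sign, and is
  nonpositive from then on; hence this \<open>M\<close>.\<close>

lemma T0_summable: "summable (\<lambda>k. \<bar>T0 k\<bar>)"
proof (rule telescope_two_bound[where \<sigma> = "-1" and M = "s (5/6)"])
  show "0 \<le> - 1 * T0 k" for k using T0_nonpos[of k] by simp
  fix n
  let ?t = "\<lambda>k. - 1 * T (- 1 / 6 + 1) (1 / 3) (- 1 / 6 + 1) (- 1 / 6) (- 1 / 6 + 1) k"
  have *: "0 \<le> ?t (Suc k)" for k
  proof -
    have "Q (-1/6) 2 (Suc k) \<le> 0" by (rule Q_Suc_nonpos) auto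
    moreover have "0 < s (5/6 + 2 * real (Suc k)) * (Q (1/3) (3/2) (Suc k) * Q (5/6) 1 (Suc k) * Q (5/6) 1 (Suc k))"
      by (intro mult_pos_pos Q_pos pos) auto
    ultimately have "s (5/6 + 2 * real (Suc k)) * (Q (1/3) (3/2) (Suc k) * Q (5/6) 1 (Suc k) * Q (5/6) 1 (Suc k)) * Q (-1/6) 2 (Suc k) \<le> 0"
      by (intro mult_nonneg_nonpos[OF less_imp_le])
    thus ?thesis by (simp add: T_def mult_ac)
  qed
  show "- s (5/6) \<le> sum ?t {..<n}"
  proof (cases n)
    case (Suc m)
    have "0 \<le> (\<Sum>k<m. ?t (Suc k))" by (intro sum_nonneg *)
    thus ?thesis unfolding Suc sum.lessThan_Suc_shift by simp
  qed (auto intro: less_imp_le)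
qed auto

section \<open>The accelerating iteration\<close>

text \<open>The parameters \<open>d\<close> and \<open>e\<close> differ by a half, so after one pass of \<open>telescope_one\<close> and \<open>telescope_two\<close> they have
  exchanged their roles.\<close>

abbreviation chain :: "real \<Rightarrow> nat \<Rightarrow> real" where
  "chain n \<equiv> T (2 * n - 1/6) (n/2 + 1/3) (n - 1/6) (n/2 - 1/6) (n - 1/6)"

text \<open>The state between the two relations: a and the fourth parameter d have been raised by
  one.\<close>

abbreviation chain' :: "real \<Rightarrow> nat \<Rightarrow> real" where
  "chain' n \<equiv> T (2 * n + 5/6) (n/2 + 1/3) (n - 1/6) (n/2 + 5/6) (n - 1/6)"

lemma chain_nonneg: "1 \<le> n \<Longrightarrow> 0 \<le> chain n k"
  by (intro T_nonneg) auto

text \<open>The shifted terms are nonnegative too, so \<open>M = 0\<close> and the boundary term is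
  the whole bound. Its denominator has the argument a - c - e = 1/6 for every n.\<close>

lemma chain_summable_bound:
  assumes "1 \<le> n"
  shows "summable (\<lambda>k. \<bar>chain n k\<bar>)" and "suminf (chain n) \<le> (s n)\<^sup>2 / s (1/6)"
proof -
  have t: "- 0 \<le> (\<Sum>k<N. 1 * T (2 * n - 1/6 + 1) (n/2 + 1/3) (n - 1/6 + 1) (n/2 - 1/6) (n - 1/6 + 1) k)" for N
    unfolding mult_1 minus_zero by (intro sum_nonneg T_nonneg) (use assms in auto)
  show "summable (\<lambda>k. \<bar>chain n k\<bar>)"
    by (rule telescope_two_bound[OF _ _ _ _ _ _ _ _ _ _ _ _ _ t])
       (use assms chain_nonneg[of n] in \<open>auto simp: mult_nonneg_nonneg\<close>)
  have "1 * suminf (chain n) \<le> 1 * (s (2 * n - 1/6 - (n - 1/6)) * s (2 * n - 1/6 - (n - 1/6)) / s (2 * n - 1/6 - (n - 1/6) - (n - 1/6)))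
    + s (1 + (2 * n - 1/6) - (n/2 + 1/3) - (n/2 - 1/6)) * (s (n - 1/6) * s (n - 1/6)) / (s (2 * n - 1/6 - (n - 1/6) - (n - 1/6)) *
       s (1 + (2 * n - 1/6) - (n/2 + 1/3)) * s (1 + (2 * n - 1/6) - (n/2 - 1/6))) * 0"
    by (rule telescope_two_bound(2)[OF _ _ _ _ _ _ _ _ _ _ _ _ _ t])
       (use assms chain_nonneg[of n] in \<open>auto simp: mult_nonneg_nonneg\<close>)
  thus "suminf (chain n) \<le> (s n)\<^sup>2 / s (1/6)"
    by (simp add: power2_eq_square)
qed

lemma chain_summable: "n = 0 \<or> 1 \<le> n \<Longrightarrow> summable (\<lambda>k. \<bar>chain n k\<bar>)"
  using T0_summable chain_summable_bound(1)[of n] by auto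

lemma chain'_summable: 
  assumes "0 \<le> n"
  shows "summable (\<lambda>k. \<bar>chain' n k\<bar>)"
proof -
  have t: "- 0 \<le> (\<Sum>k<N. 1 * T (2 * n + 5/6 + 1) (n/2 + 1/3) (n - 1/6 + 1) (n/2 + 5/6) (n - 1/6 + 1) k)" for N
    unfolding mult_1 minus_zero by (intro sum_nonneg T_nonneg) (use assms in auto)
  have "0 \<le> chain' n k" for k by (intro T_nonneg) (use assms in auto)
  thus ?thesis
    by (intro telescope_two_bound[OF _ _ _ _ _ _ _ _ _ _ _ _ _ t])
       (use assms in \<open>auto simp: mult_nonneg_nonneg\<close>)
qed

text \<open>The boundary term of \<open>telescope_one\<close> plus that of
  \<open>telescope_two\<close> weighted by the coefficient in \<open>telescope_one\<close>.\<close>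

definition g :: "real \<Rightarrow> real" where
  "g n = (s (3/2 * n) * s (3/2 * n + 2/3) + s (n/2 - 1/6) * (s (n/2 + 2/3))\<^sup>2 / s (3/2 * n + 1/2)) / s (n + 5/6)"

text \<open>The product of the coefficients in the two relations.\<close>

definition \<rho> :: "real \<Rightarrow> real" where
  "\<rho> n = - (s (n/2 - 1/6) * (s (n/2 + 2/3))\<^sup>2 * s (n + 2/3) * (s (n - 1/6))\<^sup>2) /
     (s (n + 5/6) * (s (n + 1))\<^sup>2 * s (3/2 * n + 1/2) * s (3/2 * n + 1) * s (3/2 * n + 3/2))"

lemma chain_step:
  assumes "n = 0 \<or> 1 \<le> n"
  shows "suminf (chain n) = g n + \<rho> n * suminf (chain (n + 1))"
proof -
  have n: "0 \<le> n" using assms by auto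
  have k: "2 * n - 1/6 + 2 * real k \<noteq> 0" for k
    using assms by (cases k) auto
  \<comment> \<open>The coefficients of the two relations; \<open>s (7/6)\<close> cancels both in
    \<open>r1 * r2\<close> and in the boundary terms.\<close>
  define r1 where "r1 = s (n/2 - 1/6) * s (7/6) * (s (n/2 + 2/3))\<^sup>2 / (s (n + 5/6) * (s (n + 1))\<^sup>2 * s (3/2 * n + 1/2))"
  define r2 where "r2 = - s (n + 2/3) * (s (n - 1/6))\<^sup>2 / (s (7/6) * s (3/2 * n + 3/2) * s (3/2 * n + 1))"
  let ?G = "G (2 * n - 1/6) (n - 1/6) (n - 1/6) (n/2 + 1/3) (n/2 - 1/6) (3/2 * n) (3/2 * n + 2/3) (n + 5/6)"
  have 1: "chain n k = r1 * chain' n k + (?G (Suc k) - ?G k)" for k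
  proof -
    have e: "2 * n - 1/6 + 1 = 2 * n + 5/6" "n/2 - 1/6 + 1 = n/2 + 5/6"
      "2 * n - 1/6 - (n/2 - 1/6) = 3/2 * n" "3/2 * n + 2/3 - (n/2 - 1/6) = n + 5/6"
      "1 + (2 * n - 1/6) - (n - 1/6) - (n - 1/6) = 7/6"
      "1 + (2 * n - 1/6) - (n - 1/6) - (n/2 + 1/3) = n/2 + 2/3"
      "1 + (2 * n - 1/6) - (n - 1/6) = n + 1"
      "1 + (2 * n - 1/6) - (n/2 + 1/3) = 3/2 * n + 1/2"
      by (auto simp: field_simps)
    \<comment> \<open>\<open>telescope_one\<close> raises its last parameter, which has to be the
      fourth one of \<open>chain\<close>.\<close>
    have "T (2 * n - 1/6) (n - 1/6) (n - 1/6) (n/2 + 1/3) (n/2 - 1/6) k =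
        r1 * T (2 * n + 5/6) (n - 1/6) (n - 1/6) (n/2 + 1/3) (n/2 + 5/6) k + (?G (Suc k) - ?G k)"
      using telescope_one[of "2 * n - 1/6" "n - 1/6" "n - 1/6" "n/2 + 1/3" "n/2 - 1/6" "3/2 * n + 2/3" k] n k
      unfolding e r1_def by (simp add: power2_eq_square)
    thus ?thesis
      using T_perm(1)[of "2 * n - 1/6" "n/2 + 1/3" "n - 1/6" "n/2 - 1/6" "n - 1/6" k]
        T_perm(1)[of "2 * n + 5/6" "n/2 + 1/3" "n - 1/6" "n/2 + 5/6" "n - 1/6" k] by simp
  qed
  let ?H = "G (2 * n + 5/6) (n/2 + 1/3) (n - 1/6) (n/2 + 5/6) (n - 1/6) (n + 1) (n + 1) (7/6)"
  have 2: "chain' n k = r2 * chain (n + 1) k + (?H (Suc k) - ?H k)" for k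
  proof -
    have e: "2 * n + 5/6 + 1 = 2 * (n + 1) - 1/6" "n - 1/6 + 1 = n + 1 - 1/6" "n/2 + 5/6 = (n + 1)/2 + 1/3"
      "n/2 + 1/3 = (n + 1)/2 - 1/6"
      by (auto simp: field_simps)
    have e': "2 * n + 5/6 - (n - 1/6) = n + 1" "n + 1 - (n - 1/6) = 7/6"
      "1 + (2 * n + 5/6) - (n/2 + 1/3) - (n/2 + 5/6) = n + 2/3"
      "1 + (2 * n + 5/6) - (n/2 + 1/3) = 3/2 * n + 3/2"
      "1 + (2 * n + 5/6) - (n/2 + 5/6) = 3/2 * n + 1"
      by (auto simp: field_simps)
    have "chain' n k = r2 * T (2 * n + 5/6 + 1) (n/2 + 1/3) (n - 1/6 + 1) (n/2 + 5/6) (n - 1/6 + 1) k + (?H (Suc k) - ?H k)"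
      using telescope_two[of "2 * n + 5/6" "n/2 + 1/3" "n - 1/6" "n/2 + 5/6" "n - 1/6" k] n
      unfolding e' r2_def by (simp add: power2_eq_square mult_ac)
    thus ?thesis
      using T_perm[of "2 * (n + 1) - 1/6" "(n + 1)/2 + 1/3" "n + 1 - 1/6" "(n + 1)/2 - 1/6" "n + 1 - 1/6" k]
      unfolding e(1,2) unfolding e(3,4) by (simp add: T_def mult_ac)
  qed
  have "suminf (chain' n) = s (n + 1) * s (n + 1) / s (7/6) + r2 * suminf (chain (n + 1))"
    by (rule suminf_step[OF 2]) (use n chain'_summable chain_summable[of "n + 1"] in \<open>auto intro: summable_rabs_cancel\<close>)
  moreover have "suminf (T (2 * n - 1/6) (n - 1/6) (n - 1/6) (n/2 + 1/3) (n/2 - 1/6)) =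
      s (3/2 * n) * s (3/2 * n + 2/3) / s (n + 5/6) + r1 * suminf (chain' n)"
    by (rule suminf_step) (use 1 n k[of 0] chain'_summable[of n] chain_summable[OF assms] T_perm(1)[of "2 * n - 1/6" "n - 1/6" "n - 1/6" "n/2 + 1/3" "n/2 - 1/6"]
       in \<open>auto intro: summable_rabs_cancel simp: T_perm\<close>)
  moreover have "T (2 * n - 1/6) (n - 1/6) (n - 1/6) (n/2 + 1/3) (n/2 - 1/6) = chain n"
    by (simp add: fun_eq_iff T_def mult_ac)
  ultimately have "suminf (chain n) = s (3/2 * n) * s (3/2 * n + 2/3) / s (n + 5/6)
      + r1 * (s (n + 1) * s (n + 1) / s (7/6)) + r1 * r2 * suminf (chain (n + 1))"
    by (simp add: algebra_simps)
  moreover have "r1 * r2 = \<rho> n"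
    using n by (simp add: r1_def r2_def \<rho>_def mult_ac)
  moreover have "s (3/2 * n) * s (3/2 * n + 2/3) / s (n + 5/6) + r1 * (s (n + 1) * s (n + 1) / s (7/6)) = g n"
    using n by (simp add: r1_def g_def power2_eq_square add_divide_distrib)
  ultimately show ?thesis by simp
qed

section \<open>Vanishing of the remainder\<close>

definition C :: "nat \<Rightarrow> real" where "C n = (\<Prod>j<n. \<rho> (real j))"

lemma C_0 [simp]: "C 0 = 1" and C_Suc: "C (Suc n) = C n * \<rho> (real n)"
  by (simp_all add: C_def)

lemma chain_partial: "suminf (chain 0) = (\<Sum>j<n. C j * g (real j)) + C n * suminf (chain (real n))"
proof (induction n)
  case (Suc n)
  have "suminf (chain (real n)) = g (real n) + \<rho> (real n) * suminf (chain (real n + 1))"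
    by (rule chain_step) (cases n, auto)
  thus ?case unfolding Suc by (simp add: C_Suc algebra_simps)
qed simp

lemma double_le:
  assumes "0 < x" "2 * x \<le> y"
  shows "s x \<le> s y / 2"
proof -
  have "s x * (2 * x) \<le> x * s (2 * x)" using assms by (intro ratio_le) auto
  hence "x * (2 * s x) \<le> x * s (2 * x)" by (simp add: mult_ac)
  hence "2 * s x \<le> s (2 * x)" using assms by (subst (asm) mult_le_cancel_left_pos) auto
  also have "\<dots> \<le> s y" using assms by (intro mono) auto
  finally show ?thesis by simp
qed

text \<open>Brackets are compared in pairs; each of the two copies of \<open>s (n/2 + 2/3)\<close>
  gains a factor 1/2 by \<open>double_le\<close>.\<close>

lemma abs_\<rho>_le:
  assumes "1 \<le> n"
  shows "\<bar>\<rho> n\<bar> \<le> 1/4"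
proof -
  let ?d = "s (n + 5/6) * (s (n + 1))\<^sup>2 * s (3/2 * n + 1/2) * s (3/2 * n + 1) * s (3/2 * n + 3/2)"
  let ?n = "s (n/2 - 1/6) * (s (n/2 + 2/3))\<^sup>2 * s (n + 2/3) * (s (n - 1/6))\<^sup>2"
  have pos: "0 < ?d" "0 \<le> ?n" using assms by (intro mult_pos_pos mult_nonneg_nonneg; simp)+
  have "s (n/2 - 1/6) * ((s (n/2 + 2/3) * s (n/2 + 2/3)) * (s (n + 2/3) * (s (n - 1/6))\<^sup>2))
     \<le> s (3/2 * n + 1/2) * ((s (3/2 * n + 1) / 2 * (s (3/2 * n + 3/2) / 2)) * (s (n + 5/6) * (s (n + 1))\<^sup>2))"
    using assms by (intro mult_mono mono double_le power_mono mult_nonneg_nonneg) auto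
  hence "?n \<le> ?d / 4" by (simp add: power2_eq_square mult_ac)
  moreover have "\<rho> n = - (?n / ?d)" by (simp add: \<rho>_def)
  hence "\<bar>\<rho> n\<bar> = ?n / ?d" using pos by (metis abs_minus_cancel abs_of_nonneg divide_nonneg_pos)
  ultimately show ?thesis using pos by (simp add: pos_divide_le_eq)
qed

text \<open>The bound on the remaining series is a squared bracket, which for small q grows faster
  than \<open>abs_\<rho>_le\<close> can compensate. One factor \<rho> absorbs this square and leaves
  a polynomial.\<close>

lemma abs_\<rho>_mult_le:
  assumes "1 \<le> n"
  shows "\<bar>\<rho> n\<bar> * (s (n + 1))\<^sup>2 \<le> (K * (n + 1))\<^sup>2"
proof -
  let ?d = "s (n + 5/6) * s (3/2 * n + 1/2) * s (3/2 * n + 1) * s (3/2 * n + 3/2)"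
  let ?n = "s (n/2 - 1/6) * (s (n/2 + 2/3))\<^sup>2 * s (n + 2/3) * (s (n - 1/6))\<^sup>2"
  have pos: "0 < ?d" "0 \<le> ?n" using assms by (intro mult_pos_pos mult_nonneg_nonneg; simp)+
  have 1: "s (n - 1/6) * s (n/2 + 2/3) \<le> K * (n + 1) * s z" if "3/2 * n + 1/2 \<le> z" for z
  proof -
    have "s (n - 1/6) * s (n/2 + 2/3) \<le> K * (n/2 + 2/3) * s (n - 1/6 + (n/2 + 2/3))"
      using assms by (intro mult_le) auto
    also have "\<dots> \<le> K * (n + 1) * s z"
      using assms that K_pos by (intro mult_mono mono) auto
    finally show ?thesis .
  qed
  have "s (n/2 - 1/6) * (s (n + 2/3) * ((s (n - 1/6) * s (n/2 + 2/3)) * (s (n - 1/6) * s (n/2 + 2/3))))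
     \<le> s (3/2 * n + 3/2) * (s (n + 5/6) * ((K * (n + 1) * s (3/2 * n + 1/2)) * (K * (n + 1) * s (3/2 * n + 1))))"
    using assms K_pos by (intro mult_mono mono 1 mult_nonneg_nonneg) auto
  hence "?n \<le> (K * (n + 1))\<^sup>2 * ?d" by (simp add: power2_eq_square mult_ac)
  moreover have "\<bar>\<rho> n\<bar> * (s (n + 1))\<^sup>2 = ?n / ?d"
    using pos assms unfolding \<rho>_def by (simp add: abs_mult abs_divide)
  ultimately show ?thesis using pos by (simp add: pos_divide_le_eq)
qed

lemma abs_C_le: "1 \<le> n \<Longrightarrow> \<bar>C n\<bar> \<le> 4 * \<bar>C 1\<bar> * (1/4) ^ n"
proof (induction n rule: nat_induct_at_least)
  case (Suc n)
  have "\<bar>C n\<bar> * \<bar>\<rho> (real n)\<bar> \<le> 4 * \<bar>C 1\<bar> * (1/4) ^ n * (1/4)"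
    using Suc by (intro mult_mono abs_\<rho>_le) auto
  thus ?case by (simp add: C_Suc abs_mult)
qed simp

lemma C_mult_tendsto_0:
  assumes "\<And>n. 1 \<le> n \<Longrightarrow> \<bar>x n\<bar> \<le> B * \<bar>C n\<bar> * (real n + 1)\<^sup>2"
  shows "x \<longlonglongrightarrow> 0"
proof (rule Lim_null_comparison)
  \<comment> \<open>(1/4)^n (n + 1)^2 is the square of this null sequence.\<close>
  have "(\<lambda>n. real n * (1/2) ^ n + (1/2) ^ n) \<longlonglongrightarrow> (0 :: real) + 0"
    by (intro tendsto_add powser_times_n_limit_0 LIMSEQ_power_zero) auto
  hence "(\<lambda>n. \<bar>B\<bar> * (4 * \<bar>C 1\<bar>) * (real n * (1/2) ^ n + (1/2) ^ n)\<^sup>2) \<longlonglongrightarrow> \<bar>B\<bar> * (4 * \<bar>C 1\<bar>) * (0 + 0)\<^sup>2"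
    by (intro tendsto_mult tendsto_const tendsto_power)
  thus "(\<lambda>n. \<bar>B\<bar> * (4 * \<bar>C 1\<bar>) * (real n * (1/2) ^ n + (1/2) ^ n)\<^sup>2) \<longlonglongrightarrow> 0" by simp
  show "eventually (\<lambda>n. norm (x n) \<le> \<bar>B\<bar> * (4 * \<bar>C 1\<bar>) * (real n * (1/2) ^ n + (1/2) ^ n)\<^sup>2) sequentially"
    using eventually_ge_at_top[of 1]
  proof eventually_elim
    case (elim n)
    have q: "(real n * (1/2) ^ n + (1/2) ^ n)\<^sup>2 = (1/4) ^ n * (real n + 1)\<^sup>2"
    proof -
      have "(1/4 :: real) ^ n = ((1/2) ^ n)\<^sup>2" by (simp add: power_even_eq[symmetric] power_mult power2_eq_square power_mult_distrib[symmetric])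
      thus ?thesis by (simp add: power2_eq_square algebra_simps)
    qed
    have "norm (x n) \<le> \<bar>B\<bar> * \<bar>C n\<bar> * (real n + 1)\<^sup>2"
      using assms[OF elim] by (simp add: mult_right_mono order_trans[OF _ mult_right_mono[OF mult_right_mono[OF abs_ge_self]]])
    also have "\<dots> \<le> \<bar>B\<bar> * (4 * \<bar>C 1\<bar> * (1/4) ^ n) * (real n + 1)\<^sup>2"
      using abs_C_le[OF elim] by (intro mult_right_mono mult_left_mono) auto
    finally show ?case unfolding q by (simp add: mult_ac)
  qed
qed

text \<open>Shifting the index by one frees the factor \<rho> of \<open>C (Suc n)\<close> for
  \<open>abs_\<rho>_mult_le\<close>.\<close>

lemma C_chain_tendsto_0: "(\<lambda>n. C n * suminf (chain (real n))) \<longlonglongrightarrow> 0"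
proof (rule LIMSEQ_imp_Suc, rule C_mult_tendsto_0)
  fix n :: nat assume n: "1 \<le> n"
  have "0 \<le> suminf (chain (real n + 1))"
    by (intro suminf_nonneg chain_nonneg summable_rabs_cancel[OF chain_summable]) auto
  hence "\<bar>C (Suc n) * suminf (chain (real (Suc n)))\<bar> = \<bar>C n\<bar> * \<bar>\<rho> (real n)\<bar> * suminf (chain (real n + 1))"
    by (simp add: C_Suc abs_mult add_ac)
  also have "\<dots> \<le> \<bar>C n\<bar> * \<bar>\<rho> (real n)\<bar> * ((s (real n + 1))\<^sup>2 / s (1/6))"
    by (intro mult_left_mono chain_summable_bound) auto
  also have "\<dots> = \<bar>C n\<bar> * (\<bar>\<rho> (real n)\<bar> * (s (real n + 1))\<^sup>2) / s (1/6)"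
    by simp
  also have "\<dots> \<le> \<bar>C n\<bar> * (K * (real n + 1))\<^sup>2 / s (1/6)"
    using n by (intro divide_right_mono mult_left_mono abs_\<rho>_mult_le) auto
  finally show "\<bar>C (Suc n) * suminf (chain (real (Suc n)))\<bar> \<le> K\<^sup>2 / s (1/6) * \<bar>C n\<bar> * (real n + 1)\<^sup>2"
    by (simp add: power_mult_distrib mult_ac)
qed

section \<open>From the iterated summand to the displayed one\<close>

text \<open>The iteration produces the summand \<open>C n * g n\<close>, which differs from the required one by the
  telescoping difference of \<open>C n * h n\<close>.\<close>

definition h :: "real \<Rightarrow> real" where
  "h n = (s n)\<^sup>2 * s (3/2 * n) * s (3/2 * n - 1/2) / (s (1/6) * (s (n/2 + 1/6))\<^sup>2 * s (n - 1/3))"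

lemma \<rho>_h:
  assumes "0 \<le> n"
  shows "\<rho> n * h (n + 1) = - (s (n/2 - 1/6) * (s (n - 1/6))\<^sup>2 / (s (1/6) * s (n + 5/6) * s (3/2 * n + 1/2)))"
proof -
  have e: "3/2 * (n + 1) = 3/2 * n + 3/2" "3/2 * n + 3/2 - 1/2 = 3/2 * n + 1" "(n + 1)/2 + 1/6 = n/2 + 2/3"
    "n + 1 - 1/3 = n + 2/3" by (auto simp: field_simps)
  have nz: "s (n + 5/6) \<noteq> 0" "s (n + 1) \<noteq> 0" "s (3/2 * n + 1/2) \<noteq> 0" "s (3/2 * n + 1) \<noteq> 0" "s (3/2 * n + 3/2) \<noteq> 0"
    "s (n/2 + 2/3) \<noteq> 0" "s (n + 2/3) \<noteq> 0" "s (1/6) \<noteq> 0"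
    using assms by auto
  show ?thesis unfolding \<rho>_def h_def e using nz by (simp add: divide_simps del: eq_0_iff)
qed

lemma C_h_tendsto_0: "(\<lambda>n. C n * h (real n)) \<longlonglongrightarrow> 0"
proof (rule LIMSEQ_imp_Suc, rule C_mult_tendsto_0)
  fix n :: nat assume n: "1 \<le> n"
  have "s (real n - 1/6) * s (real n / 2 - 1/6) \<le> K * (real n / 2 - 1/6) * s (real n - 1/6 + (real n / 2 - 1/6))"
    using n by (intro mult_le) auto
  also have "\<dots> \<le> K * (real n + 1)\<^sup>2 * s (3/2 * real n + 1/2)"
    using n K_pos by (intro mult_mono mono) (auto simp: power2_eq_square algebra_simps)
  finally have *: "s (real n - 1/6) * s (real n / 2 - 1/6) \<le> \<dots>" .
  have "(s (real n - 1/6) * s (real n / 2 - 1/6)) * s (real n - 1/6) \<le> K * (real n + 1)\<^sup>2 * s (3/2 * real n + 1/2) * s (real n + 5/6)"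
    using n K_pos by (intro mult_mono[OF * mono]) auto
  hence "s (real n/2 - 1/6) * (s (real n - 1/6))\<^sup>2 / (s (real n + 5/6) * s (3/2 * real n + 1/2)) \<le> K * (real n + 1)\<^sup>2"
    by (simp add: pos_divide_le_eq power2_eq_square mult_ac)
  hence "s (real n/2 - 1/6) * (s (real n - 1/6))\<^sup>2 / (s (real n + 5/6) * s (3/2 * real n + 1/2)) / s (1/6) \<le> K * (real n + 1)\<^sup>2 / s (1/6)"
    by (intro divide_right_mono) auto
  moreover have "\<bar>\<rho> (real n) * h (real n + 1)\<bar> = s (real n/2 - 1/6) * (s (real n - 1/6))\<^sup>2 / (s (real n + 5/6) * s (3/2 * real n + 1/2)) / s (1/6)"
    using n by (simp add: \<rho>_h abs_mult abs_divide abs_s)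
  ultimately have "\<bar>\<rho> (real n) * h (real n + 1)\<bar> \<le> K * (real n + 1)\<^sup>2 / s (1/6)" by simp
  hence "\<bar>C n\<bar> * \<bar>\<rho> (real n) * h (real n + 1)\<bar> \<le> \<bar>C n\<bar> * (K * (real n + 1)\<^sup>2 / s (1/6))"
    by (intro mult_left_mono) auto
  thus "\<bar>C (Suc n) * h (real (Suc n))\<bar> \<le> K / s (1/6) * \<bar>C n\<bar> * (real n + 1)\<^sup>2"
    by (simp add: C_Suc abs_mult mult_ac add_ac)
qed

text \<open>The quotient of the displayed coefficient by \<open>C n\<close>, as
  \<open>display_closed_form\<close> shows; \<open>display_ratio\<close> is the second summand in
  the braces.\<close>

definition display_factor :: "real \<Rightarrow> real" where
  "display_factor n = s (n/2 - 1/6) * s (n/2 + 1/3) * (s (n - 1/6))\<^sup>2 / (s (1/6) * (s (n/2 + 1/6))\<^sup>2 * s (n - 1/3))"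

definition display_ratio :: "real \<Rightarrow> real" where
  "display_ratio n = s (3/2 * n) * s (2 * n - 1/6) / (s (n/2 + 1/3) * s (n - 1/6))"

lemma display_identity:
  "s (x - 1/6) * s (2*x - 1/6) * (s (x + 1/3) * s (2*x - 1/6) + s (3*x) * s (4*x - 1/6)) =
     (s (2*x))\<^sup>2 * s (3*x) * s (3*x - 1/2) - s (4*x - 1/6) * (s (x + 1/6))\<^sup>2 * s (2*x - 1/3)"
proof -
  have 1: "s (3*x) * s (3*x - 1/2) = s (x + 1/3) * s (x - 1/6) + s (2*x - 1/3) * s (4*x - 1/6)"
    using three_term[of "x + 1/3" "1/6 - x" "3*x" "1/2 - 3*x"] minus[of "x - 1/6"] minus[of "3*x - 1/2"]
      minus[of "2*x - 1/3"] by (simp add: algebra_simps)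
  have 2: "(s (2*x))\<^sup>2 - (s (2*x - 1/6))\<^sup>2 = s (4*x - 1/6) * s (1/6)"
    using mult_diff[of "2*x" "2*x - 1/6"] by (simp add: algebra_simps)
  have 3: "(s (2*x))\<^sup>2 - (s (x + 1/6))\<^sup>2 = s (3*x + 1/6) * s (x - 1/6)"
    using mult_diff[of "2*x" "x + 1/6"] by (simp add: algebra_simps)
  have 4: "s (2*x - 1/6) * s (3*x) = s (x + 1/3) * s (1/6) + s (3*x + 1/6) * s (2*x - 1/3)"
    using three_term[of "3*x + 1/6" "2*x - 1/3" "2*x - 1/6" "3*x"] by (simp add: algebra_simps)
  \<comment> \<open>On the right, 1 and then 3 expose the factor \<open>s (x - 1/6)\<close>; in the
    cofactor, 2 and then 4 expose \<open>s (2*x - 1/6)\<close>.\<close>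
  show ?thesis using 1 2 3 4 by algebra
qed

lemma display_term:
  assumes "n = 0 \<or> 1 \<le> n"
  shows "display_factor n * (1 + display_ratio n) = g n / s (- 1/6) + h n - \<rho> n * h (n + 1)"
proof -
  define x where "x = n / 2"
  have n: "n = 2 * x" by (simp add: x_def)
  have x: "x = 0 \<or> 1/2 \<le> x" using assms unfolding x_def by auto
  have nz: "s (1/6) \<noteq> 0" "s (x + 1/6) \<noteq> 0" "s (2*x - 1/3) \<noteq> 0" "s (x + 1/3) \<noteq> 0" "s (2*x - 1/6) \<noteq> 0"
    "s (2*x + 5/6) \<noteq> 0" "s (3*x + 1/2) \<noteq> 0" using x by auto
  have 1: "(s (2*x - 1/6))\<^sup>2 - (s (x + 2/3))\<^sup>2 = s (3*x + 1/2) * s (x - 5/6)"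
    using mult_diff[of "2*x - 1/6" "x + 2/3"] by (simp add: algebra_simps)
  have 2: "s (x - 1/6) * s (x - 5/6) - s (3*x) * s (3*x + 2/3) = - s (2*x + 5/6) * s (4*x - 1/6)"
    using three_term[of "3*x + 2/3" "- 3*x" "x - 1/6" "5/6 - x"] minus[of "3*x"] minus[of "x - 5/6"]
    by (simp add: algebra_simps)
  have L: "display_factor n * (1 + display_ratio n) * s (1/6) = s (x - 1/6) * s (2*x - 1/6) * (s (x + 1/3) * s (2*x - 1/6) + s (3*x) * s (4*x - 1/6)) / ((s (x + 1/6))\<^sup>2 * s (2*x - 1/3))"
    unfolding display_factor_def display_ratio_def n using nz by (simp add: divide_simps del: eq_0_iff) (simp add: algebra_simps power2_eq_square)
  have G: "g n / s (- 1/6) * s (1/6) = - ((s (3*x) * s (3*x + 2/3) + s (x - 1/6) * (s (x + 2/3))\<^sup>2 / s (3*x + 1/2)) / s (2*x + 5/6))"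
    unfolding g_def n using nz minus[of "1/6"] by (simp del: eq_0_iff)
  have H: "h n * s (1/6) = (s (2*x))\<^sup>2 * s (3*x) * s (3*x - 1/2) / ((s (x + 1/6))\<^sup>2 * s (2*x - 1/3))"
    unfolding h_def n using nz by (simp del: eq_0_iff)
  have RH: "\<rho> n * h (n + 1) * s (1/6) = - (s (x - 1/6) * (s (2*x - 1/6))\<^sup>2 / (s (2*x + 5/6) * s (3*x + 1/2)))"
    using x nz by (subst \<rho>_h) (auto simp: n simp del: eq_0_iff)
  \<comment> \<open>These two terms collapse to one bracket: 1 extracts
    \<open>s (3*x + 1/2)\<close>, and 2 then extracts \<open>s (2*x + 5/6)\<close>.\<close>
  have "(g n / s (- 1/6) - \<rho> n * h (n + 1)) * s (1/6) = - s (4*x - 1/6)"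
  proof -
    have "(g n / s (- 1/6) - \<rho> n * h (n + 1)) * s (1/6) * (s (2*x + 5/6) * s (3*x + 1/2)) =
       s (x - 1/6) * ((s (2*x - 1/6))\<^sup>2 - (s (x + 2/3))\<^sup>2) - s (3*x) * s (3*x + 2/3) * s (3*x + 1/2)"
      unfolding left_diff_distrib G RH using nz by (simp add: divide_simps del: eq_0_iff) (simp add: algebra_simps)
    also have "\<dots> = s (3*x + 1/2) * (s (x - 1/6) * s (x - 5/6) - s (3*x) * s (3*x + 2/3))"
      unfolding 1 by (simp add: algebra_simps)
    also have "\<dots> = - s (4*x - 1/6) * (s (2*x + 5/6) * s (3*x + 1/2))"
      unfolding 2 by simp
    finally show ?thesis using nz by (simp only: mult_cancel_right mult_eq_0_iff) blast
  qed
  hence "(g n / s (- 1/6) + h n - \<rho> n * h (n + 1)) * s (1/6) = h n * s (1/6) - s (4*x - 1/6)"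
    by (simp add: algebra_simps)
  also have "\<dots> = display_factor n * (1 + display_ratio n) * s (1/6)"
    unfolding L display_identity H using nz by (simp add: divide_simps del: eq_0_iff)
  finally show ?thesis using nz by simp
qed

lemma sums_C: "(\<lambda>n. C n * (display_factor (real n) * (1 + display_ratio (real n)))) sums (suminf T0 / s (- 1/6))"
proof -
  have "(\<Sum>j<n. C j * (display_factor (real j) * (1 + display_ratio (real j)))) =
      (suminf T0 - C n * suminf (chain (real n))) / s (- 1/6) - C n * h (real n)" for n
  proof (induction n)
    case 0
    \<comment> \<open>\<open>h 0 = 0\<close> because of its factor \<open>s 0\<close>, so
      telescoping leaves nothing at the lower end.\<close>
    thus ?case using chain_partial[of 0] by (simp add: h_def)
  next
    case (Suc n)
    have "display_factor (real n) * (1 + display_ratio (real n)) = g (real n) / s (- 1/6) + h (real n) - \<rho> (real n) * h (real n + 1)"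
      by (rule display_term) (cases n, auto)
    moreover have chain: "suminf (chain (real n)) = g (real n) + \<rho> (real n) * suminf (chain (real n + 1))"
      by (rule chain_step) (cases n, auto)
    define t where "t = suminf (chain (real n + 1))"
    have S: "real (Suc n) = real n + 1" by simp
    ultimately show ?case unfolding sum.lessThan_Suc Suc C_Suc S chain t_def[symmetric]
      by (simp add: ring_distribs add_divide_distrib diff_divide_distrib mult_ac)
  qed
  moreover have "(\<lambda>n. (suminf T0 - C n * suminf (chain (real n))) / s (- 1/6) - C n * h (real n))
      \<longlonglongrightarrow> (suminf T0 - 0) / s (- 1/6) - 0"
    by (intro tendsto_intros C_chain_tendsto_0 C_h_tendsto_0) auto
  ultimately show ?thesis by (simp add: sums_def)
qed

section \<open>The product formula\<close>

text \<open>At \<open>m = 0\<close> this is again \<open>T0\<close>; since \<open>e = a\<close>, \<open>telescope_one\<close> has no boundary term and only multiplies the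
  sum by a factor.\<close>

abbreviation dougall :: "real \<Rightarrow> nat \<Rightarrow> real" where
  "dougall m \<equiv> T (m - 1/6) (1/3) (-1/6) (m - 1/6) (-1/6)"

definition R :: "real \<Rightarrow> real" where
  "R m = s (m + 7/6) * (s (m + 2/3))\<^sup>2 / ((s (m + 1))\<^sup>2 * s (m + 1/2))"

lemma dougall_summable_bound:
  assumes "1 \<le> m"
  shows "summable (\<lambda>k. \<bar>dougall m k\<bar>)" "suminf (dougall m) \<le> (s m)\<^sup>2 / s (m + 1/6)" "0 \<le> dougall m k"
proof -
  show nonneg: "0 \<le> dougall m k" for k
    by (intro T_nonneg) (use assms in auto)
  have t: "- 0 \<le> (\<Sum>k<N. 1 * T (m - 1/6 + 1) (1/3) (-1/6 + 1) (m - 1/6) (-1/6 + 1) k)" for N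
    unfolding mult_1 minus_zero by (intro sum_nonneg T_nonneg) (use assms in auto)
  show "summable (\<lambda>k. \<bar>dougall m k\<bar>)"
    by (rule telescope_two_bound[OF _ _ _ _ _ _ _ _ _ _ _ _ _ t]) (use assms nonneg in auto)
  have "1 * suminf (dougall m) \<le> 1 * (s (m - 1/6 - (-1/6)) * s (m - 1/6 - (-1/6)) / s (m - 1/6 - (-1/6) - (-1/6)))
    + s (1 + (m - 1/6) - 1/3 - (m - 1/6)) * (s (-1/6) * s (-1/6)) / (s (m - 1/6 - (-1/6) - (-1/6)) *
       s (1 + (m - 1/6) - 1/3) * s (1 + (m - 1/6) - (m - 1/6))) * 0"
    by (rule telescope_two_bound(2)[OF _ _ _ _ _ _ _ _ _ _ _ _ _ t]) (use assms nonneg in auto)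
  thus "suminf (dougall m) \<le> (s m)\<^sup>2 / s (m + 1/6)"
    by (simp add: power2_eq_square)
qed

lemma dougall_summable: "m = 0 \<or> 1 \<le> m \<Longrightarrow> summable (\<lambda>k. \<bar>dougall m k\<bar>)"
  using T0_summable dougall_summable_bound(1)[of m] by auto

lemma dougall_step:
  assumes "m = 0 \<or> 1 \<le> m"
  shows "suminf (dougall m) / s (m - 1/6) = R m * (suminf (dougall (m + 1)) / s (m + 5/6))"
proof -
  have m: "0 \<le> m" "s (m - 1/6) \<noteq> 0" using assms by auto
  have k: "m - 1/6 + 2 * real k \<noteq> 0" for k
    using assms by (cases k) auto
  define r where "r = s (m - 1/6) * s (m + 7/6) * (s (m + 2/3))\<^sup>2 / (s (m + 5/6) * (s (m + 1))\<^sup>2 * s (m + 1/2))"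
  let ?G = "G (m - 1/6) (-1/6) (-1/6) (1/3) (m - 1/6) 0 (2 * m + 2/3) (m + 5/6)"
  have eq: "T (m - 1/6) (-1/6) (-1/6) (1/3) (m - 1/6) k = r * dougall (m + 1) k + (?G (Suc k) - ?G k)" for k
  proof -
    have e: "m - 1/6 + 1 = m + 1 - 1/6" "2 * m + 2/3 - (m - 1/6) = m + 5/6" "m - 1/6 - (m - 1/6) = 0"
      "1 + (m - 1/6) - (-1/6) - (-1/6) = m + 7/6"
      "1 + (m - 1/6) - (-1/6) - 1/3 = m + 2/3"
      "1 + (m - 1/6) - (-1/6) = m + 1"
      "1 + (m - 1/6) - 1/3 = m + 1/2"
      by (auto simp: field_simps)
    have "T (m - 1/6) (-1/6) (-1/6) (1/3) (m - 1/6) k =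
        r * T (m + 1 - 1/6) (-1/6) (-1/6) (1/3) (m + 1 - 1/6) k + (?G (Suc k) - ?G k)"
      using telescope_one[of "m - 1/6" "-1/6" "-1/6" "1/3" "m - 1/6" "2 * m + 2/3" k] m k
      unfolding e r_def by (simp add: power2_eq_square mult_ac add_ac)
    moreover have "T (m + 1 - 1/6) (-1/6) (-1/6) (1/3) (m + 1 - 1/6) k = dougall (m + 1) k"
      by (rule T_perm(1)[symmetric])
    ultimately show ?thesis by simp
  qed
  have p: "T (m - 1/6) (-1/6) (-1/6) (1/3) (m - 1/6) = dougall m"
    by (simp add: fun_eq_iff T_def mult_ac)
  have "suminf (T (m - 1/6) (-1/6) (-1/6) (1/3) (m - 1/6)) =
      s 0 * s (2 * m + 2/3) / s (m + 5/6) + r * suminf (dougall (m + 1))"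
    by (rule suminf_step[OF eq])
       (use p m k[of 0] dougall_summable[OF assms] dougall_summable[of "m + 1"] in \<open>auto intro: summable_rabs_cancel\<close>)
  thus ?thesis using m unfolding p r_def R_def by (simp add: mult_ac)
qed

text \<open>The first term of the nonnegative series gives the lower bound 1. By
  \<open>mult_diff\<close> the upper bound exceeds 1 by (s (1/6))^2 / (s (m - 1/6) s (m + 1/6)),
  which \<open>ratio_le\<close> makes O(1/m).\<close>

lemma dougall_tendsto: "(\<lambda>m. suminf (dougall (real m)) / s (real m - 1/6)) \<longlonglongrightarrow> 1"
proof -
  let ?B = "(s (1/6))\<^sup>2 / (s (5/6) * s 1)"
  have "(\<lambda>m. 1 + ?B * (1 / real m)) \<longlonglongrightarrow> 1 + ?B * 0"
    by (intro tendsto_intros lim_1_over_n)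
  hence lim: "(\<lambda>m. 1 + ?B * (1 / real m)) \<longlonglongrightarrow> 1" by simp
  have lower: "eventually (\<lambda>m. 1 \<le> suminf (dougall (real m)) / s (real m - 1/6)) sequentially"
    using eventually_ge_at_top[of 1]
  proof eventually_elim
    case (elim m)
    have "(\<Sum>k<1. dougall (real m) k) \<le> suminf (dougall (real m))"
      by (intro sum_le_suminf summable_rabs_cancel[OF dougall_summable] dougall_summable_bound) (use elim in auto)
    thus ?case using elim by (simp add: pos_le_divide_eq)
  qed
  have upper: "eventually (\<lambda>m. suminf (dougall (real m)) / s (real m - 1/6) \<le> 1 + ?B * (1 / real m)) sequentially"
    using eventually_ge_at_top[of 1]
  proof eventually_elim
    case (elim m)
    have p: "0 < s (real m - 1/6)" "0 < s (real m + 1/6)" using elim by auto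
    have "s 1 * real m \<le> 1 * s (real m)" using elim by (intro ratio_le) auto
    also have "\<dots> \<le> s (real m + 1/6)" by (simp add: mono)
    finally have "s (5/6) * (s 1 * real m) \<le> s (real m - 1/6) * s (real m + 1/6)"
      using elim by (intro mult_mono mono) auto
    hence "(s (1/6))\<^sup>2 / (s (real m - 1/6) * s (real m + 1/6)) \<le> (s (1/6))\<^sup>2 / (s (5/6) * (s 1 * real m))"
      using elim by (intro divide_left_mono mult_pos_pos) auto
    moreover have "(s (real m))\<^sup>2 = s (real m - 1/6) * s (real m + 1/6) + (s (1/6))\<^sup>2"
      using mult_diff[of "real m" "1/6"] by (simp add: mult_ac)
    hence "(s (real m))\<^sup>2 / s (real m + 1/6) / s (real m - 1/6) = 1 + (s (1/6))\<^sup>2 / (s (real m - 1/6) * s (real m + 1/6))"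
      using less_imp_neq[OF p(1)] less_imp_neq[OF p(2)] by (simp add: add_divide_distrib del: eq_0_iff)
    moreover have "suminf (dougall (real m)) / s (real m - 1/6) \<le> (s (real m))\<^sup>2 / s (real m + 1/6) / s (real m - 1/6)"
      using p elim by (intro divide_right_mono dougall_summable_bound) auto
    ultimately show ?case by (simp add: mult_ac)
  qed
  show ?thesis using lower upper tendsto_const lim by (rule tendsto_sandwich)
qed

lemma prod_R_tendsto: "(\<lambda>M. \<Prod>m<M. R (real m)) \<longlonglongrightarrow> suminf T0 / s (- 1/6)"
proof -
  define S where "S = (\<lambda>m. suminf (dougall (real m)) / s (real m - 1/6))"
  have S: "S \<longlonglongrightarrow> 1" unfolding S_def by (rule dougall_tendsto)
  have "S 0 = (\<Prod>m<M. R (real m)) * S M" for M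
  proof (induction M)
    case (Suc M)
    have "S M = R (real M) * S (Suc M)"
      using dougall_step[of "real M"] unfolding S_def by (cases M) (auto simp: add_ac)
    thus ?case using Suc by simp
  qed simp
  moreover have "eventually (\<lambda>M. S M \<noteq> 0) sequentially"
    using S by (rule tendsto_imp_eventually_ne) auto
  ultimately have "eventually (\<lambda>M. S 0 / S M = (\<Prod>m<M. R (real m))) sequentially"
    by (auto elim!: eventually_mono simp: field_simps)
  moreover have "(\<lambda>M. S 0 / S M) \<longlonglongrightarrow> S 0 / 1"
    by (intro tendsto_intros S) auto
  ultimately have "(\<lambda>M. \<Prod>m<M. R (real m)) \<longlonglongrightarrow> S 0 / 1"
    by (blast intro: Lim_transform_eventually)
  thus ?thesis by (simp add: S_def)
qed

section \<open>Closed form of the summand\<close>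

text \<open>Step 1/2 corresponds to the base q^(1/2), as step 1 in \<open>P\<close> does to the base
  q.\<close>

definition H :: "real \<Rightarrow> nat \<Rightarrow> real" where
  "H x n = (\<Prod>j<n. s (x + real j / 2))"

lemma H_Suc: "H x (Suc n) = H x n * s (x + real n / 2)"
  by (simp add: H_def)

lemma H_pos: "0 < x \<Longrightarrow> 0 < H x n"
  unfolding H_def by (intro prod_pos) auto

text \<open>Both sides are 1 at n = 0 and have the same ratio of consecutive terms;
  \<open>H (1/2) (3 * n)\<close> gains three brackets per step.\<close>

lemma display_closed_form:
  "(-1) ^ n * ((H (1/6) n)\<^sup>2 * H (5/6) n * (P (-1/3) n * P (5/6) n)) / ((P 1 n)\<^sup>2 * H (1/2) (3 * n)) = C n * display_factor (real n)"
proof (induction n)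
  case 0
  show ?case using minus[of "1/6"] minus[of "1/3"]
    by (simp add: H_def P_def display_factor_def power2_eq_square)
next
  case (Suc n)
  define x where "x = real n"
  let ?E = "\<lambda>n. (-1) ^ n * ((H (1/6) n)\<^sup>2 * H (5/6) n * (P (-1/3) n * P (5/6) n)) / ((P 1 n)\<^sup>2 * H (1/2) (3 * n))"
  have x: "x = 0 \<or> 1 \<le> x" unfolding x_def by (cases n) auto
  have 3: "H (1/2) (3 * Suc n) = H (1/2) (3 * n) * s (3/2 * x + 1/2) * s (3/2 * x + 1) * s (3/2 * x + 3/2)"
  proof -
    have "3 * Suc n = Suc (Suc (Suc (3 * n)))" by simp
    moreover have "1/2 + real (3 * n) / 2 = 3/2 * x + 1/2" "1/2 + real (Suc (3 * n)) / 2 = 3/2 * x + 1"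
      "1/2 + real (Suc (Suc (3 * n))) / 2 = 3/2 * x + 3/2" by (auto simp: x_def field_simps)
    ultimately show ?thesis by (simp only: H_Suc)
  qed
  have e: "1/6 + x / 2 = x/2 + 1/6" "5/6 + x / 2 = x/2 + 5/6" "-1/3 + x = x - 1/3" "5/6 + x = x + 5/6" "1 + x = x + 1"
    by auto
  have "?E (Suc n) = ?E n * (- ((s (x/2 + 1/6))\<^sup>2 * s (x/2 + 5/6) * s (x - 1/3) * s (x + 5/6)) /
      ((s (x + 1))\<^sup>2 * (s (3/2 * x + 1/2) * s (3/2 * x + 1) * s (3/2 * x + 3/2))))"
    unfolding 3 H_Suc P_Suc x_def[symmetric] e by (simp add: power2_eq_square mult_ac)
  also have "\<dots> = C n * (display_factor x * (- ((s (x/2 + 1/6))\<^sup>2 * s (x/2 + 5/6) * s (x - 1/3) * s (x + 5/6)) /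
      ((s (x + 1))\<^sup>2 * (s (3/2 * x + 1/2) * s (3/2 * x + 1) * s (3/2 * x + 3/2)))))"
    unfolding Suc x_def by (simp only: mult.assoc)
  also have "display_factor x * (- ((s (x/2 + 1/6))\<^sup>2 * s (x/2 + 5/6) * s (x - 1/3) * s (x + 5/6)) /
      ((s (x + 1))\<^sup>2 * (s (3/2 * x + 1/2) * s (3/2 * x + 1) * s (3/2 * x + 3/2)))) = \<rho> x * display_factor (x + 1)"
  proof -
    have e: "(x + 1)/2 - 1/6 = x/2 + 1/3" "(x + 1)/2 + 1/3 = x/2 + 5/6" "x + 1 - 1/6 = x + 5/6"
      "(x + 1)/2 + 1/6 = x/2 + 2/3" "x + 1 - 1/3 = x + 2/3" by (auto simp: field_simps)
    have nz: "s (1/6) \<noteq> 0" "s (x/2 + 1/6) \<noteq> 0" "s (x - 1/3) \<noteq> 0" "s (x + 1) \<noteq> 0" "s (3/2 * x + 1/2) \<noteq> 0"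
      "s (3/2 * x + 1) \<noteq> 0" "s (3/2 * x + 3/2) \<noteq> 0" "s (x + 5/6) \<noteq> 0" "s (x/2 + 2/3) \<noteq> 0" "s (x + 2/3) \<noteq> 0"
      using x by auto
    show ?thesis unfolding display_factor_def \<rho>_def e using nz
      by (simp add: divide_simps del: eq_0_iff) (simp add: power2_eq_square)
  qed
  also have "C n * (\<rho> x * display_factor (x + 1)) = C (Suc n) * display_factor (real (Suc n))"
    by (simp add: C_Suc x_def add_ac)
  finally show ?case .
qed

text \<open>\<open>L\<close> is left open because the evaluation of the product depends on the
  choice of \<open>s\<close>.\<close>

theorem accelerated_sum:
  assumes "(\<lambda>M. \<Prod>m<M. s (real m + 7/6) * (s (real m + 2/3))\<^sup>2 / ((s (real m + 1))\<^sup>2 * s (real m + 1/2))) \<longlonglongrightarrow> L"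
  shows "(\<lambda>n. (-1) ^ n * ((H (1/6) n)\<^sup>2 * H (5/6) n * (P (-1/3) n * P (5/6) n)) / ((P 1 n)\<^sup>2 * H (1/2) (3 * n))
     * (1 + s (3/2 * real n) * s (2 * real n - 1/6) / (s (real n / 2 + 1/3) * s (real n - 1/6)))) sums L"
proof -
  have "L = suminf T0 / s (- 1/6)"
    using assms prod_R_tendsto unfolding R_def by (rule LIMSEQ_unique)
  with sums_C show ?thesis
    unfolding display_closed_form display_ratio_def by (simp only: mult.assoc)
qed

end

section \<open>The two instances of the bracket\<close>

lemma sinh_mult_diff: "sinh (x + y) * sinh (x - y) = (sinh x)\<^sup>2 - (sinh y)\<^sup>2" for x y :: real
proof -
  have "sinh (x + y) * sinh (x - y) = (sinh x)\<^sup>2 * (cosh y)\<^sup>2 - (cosh x)\<^sup>2 * (sinh y)\<^sup>2"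
    by (simp add: sinh_add sinh_diff power2_eq_square algebra_simps)
  thus ?thesis by (simp add: cosh_square_eq algebra_simps)
qed

lemma sinh_mvt: "x < y \<Longrightarrow> \<exists>z>x. z < y \<and> sinh y - sinh x = (y - x) * cosh z" for x y :: real
proof -
  assume "x < y"
  moreover have "(sinh has_real_derivative cosh z) (at z)" for z :: real
    by (auto intro!: derivative_eq_intros)
  ultimately obtain z where "x < z" "z < y" "sinh y - sinh x = (y - x) * cosh z"
    using MVT2[of x y sinh cosh] by blast
  thus ?thesis by blast
qed

text \<open>Convexity: the mean slope on [0, x] is at most that on [x, y].\<close>

lemma sinh_ratio_le:
  assumes "0 < x" "x \<le> y"
  shows "sinh x * y \<le> x * sinh (y :: real)"
proof (cases "x = y")
  case False
  with assms have "x < y" by simp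
  then obtain z where z: "x < z" "sinh y - sinh x = (y - x) * cosh z" using sinh_mvt by blast
  obtain w where w: "0 < w" "w < x" "sinh x = x * cosh w" using sinh_mvt[of 0 x] assms by auto
  have "cosh w \<le> cosh z" using z w by (simp add: cosh_real_nonneg_le_iff)
  hence "(y - x) * (x * cosh w) \<le> (y - x) * (x * cosh z)"
    using assms by (intro mult_left_mono) auto
  hence "(y - x) * sinh x \<le> x * (sinh y - sinh x)"
    unfolding z(2) w(3)[symmetric] by (simp add: mult_ac)
  thus ?thesis by (simp add: algebra_simps)
qed (simp add: mult.commute)

text \<open>Combines sinh y \<le> y cosh y with sinh x cosh y \<le> sinh (x + y).\<close>

lemma sinh_mult_le:
  assumes "0 < x" "0 < y"
  shows "sinh x * sinh y \<le> y * sinh (x + y :: real)"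
proof -
  obtain w where w: "0 < w" "w < y" "sinh y = y * cosh w" using sinh_mvt[of 0 y] assms by auto
  have "cosh w \<le> cosh y" using w by (simp add: cosh_real_nonneg_le_iff)
  hence "sinh x * sinh y \<le> sinh x * (y * cosh y)"
    unfolding w(3) using assms by (intro mult_left_mono) auto
  also have "\<dots> \<le> y * sinh (x + y)"
    using assms by (simp add: sinh_add algebra_simps)
  finally show ?thesis .
qed

text \<open>With q = exp (-2h) this function is q^(-x/2) - q^(x/2).\<close>

lemma bracket_sinh:
  assumes "0 < h"
  shows "bracket (\<lambda>x. 2 * sinh (h * x)) (2 * h)"
proof
  fix x y :: real
  show "2 * sinh (h * (x + y)) * (2 * sinh (h * (x - y))) = (2 * sinh (h * x))\<^sup>2 - (2 * sinh (h * y))\<^sup>2"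
    using sinh_mult_diff[of "h * x" "h * y"] by (simp add: algebra_simps power_mult_distrib)
  show "0 < 2 * sinh (h * x)" if "0 < x" using that assms by simp
  show "2 * sinh (h * x) * y \<le> x * (2 * sinh (h * y))" if "0 < x" "x \<le> y"
    using sinh_ratio_le[of "h * x" "h * y"] that assms by (simp add: algebra_simps)
  show "2 * sinh (h * x) * (2 * sinh (h * y)) \<le> 2 * h * y * (2 * sinh (h * (x + y)))" if "0 < x" "0 < y"
    using sinh_mult_le[of "h * x" "h * y"] that assms by (simp add: algebra_simps)
qed

lemma bracket_id: "bracket (\<lambda>x. x) 1"
  by unfold_locales (simp_all add: power2_eq_square algebra_simps)

section \<open>The q-series\<close>

lemma convergent_prod_qpoch:
  fixes p x :: real
  assumes "\<bar>p\<bar> < 1"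
  shows "convergent_prod (\<lambda>j. 1 - p ^ j * x)"
proof -
  have "summable (\<lambda>j. norm (- (p ^ j * x)))"
    using assms by (auto simp: abs_mult power_abs intro!: summable_mult2 summable_geometric)
  hence "abs_convergent_prod (\<lambda>j. 1 + - (p ^ j * x))"
    by (simp only: abs_convergent_prod_conv_summable add_diff_cancel_left' diff_add_cancel)
  from abs_convergent_prod_imp_convergent_prod[OF this] show ?thesis by simp
qed

lemma qpoch_tendsto:
  assumes "\<bar>p\<bar> < 1"
  shows "qpoch x p \<longlonglongrightarrow> qpoch_inf x p"
proof -
  have "(\<lambda>n. \<Prod>j\<le>n. 1 - p ^ j * x) \<longlonglongrightarrow> qpoch_inf x p"
    unfolding qpoch_inf_def by (rule convergent_prod_LIMSEQ[OF convergent_prod_qpoch[OF assms]])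
  hence "(\<lambda>n. qpoch x p (Suc n)) \<longlonglongrightarrow> qpoch_inf x p"
    by (simp only: qpoch_def lessThan_Suc_atMost)
  thus ?thesis by (rule LIMSEQ_imp_Suc)
qed

lemma qpoch_inf_nonzero:
  assumes "0 < q" "q < 1" "0 < a"
  shows "qpoch_inf (q powr a) q \<noteq> 0"
proof -
  have "q ^ j * q powr a = q powr (real j + a)" for j
    using assms by (simp add: powr_add powr_realpow)
  moreover have "q powr (real j + a) < 1" for j
    using assms by (simp add: powr_def mult_pos_neg)
  ultimately show ?thesis
    unfolding qpoch_inf_def using assms
    by (intro prodinf_nonzero convergent_prod_qpoch) (metis abs_of_pos, metis eq_iff_diff_eq_0 less_irrefl)
qed

lemma q_series:
  fixes q :: real
  assumes q: "0 < q" "q < 1"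
  shows "(\<lambda>n::nat.
          (-1) ^ n
          * ((qpoch (q powr (1/6)) (q powr (1/2)) n)\<^sup>2
              * qpoch (q powr (5/6)) (q powr (1/2)) n
              * (qpoch (q powr (-1/3)) q n * qpoch (q powr (5/6)) q n))
          / ((qpoch q q n)\<^sup>2 * qpoch (q powr (1/2)) (q powr (1/2)) (3 * n))
          * q powr (real n * (9 * real n + 11) / 12)
          * (1 + q powr (1/6 - real n)
                 * ((1 - q powr (3/2 * real n)) * (1 - q powr (2 * real n - 1/6)))
                 / ((1 - q powr (real n / 2 + 1/3)) * (1 - q powr (real n - 1/6)))))
      sums
        ((qpoch_inf (q powr (2/3)) q)\<^sup>2 * qpoch_inf (q powr (7/6)) q
          / ((qpoch_inf q q)\<^sup>2 * qpoch_inf (q powr (1/2)) q))" (is "?t sums ?L")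
proof -
  define \<eta> where "\<eta> = - ln q / 2"
  have \<eta>: "0 < \<eta>" using q by (simp add: \<eta>_def)
  define s where "s = (\<lambda>x. 2 * sinh (\<eta> * x))"
  interpret bracket s "2 * \<eta>"
    unfolding s_def by (rule bracket_sinh[OF \<eta>])
  have one_minus: "1 - q powr x = q powr (x / 2) * s x" for x
    using q by (simp add: s_def \<eta>_def sinh_def powr_def algebra_simps exp_add[symmetric])
  \<comment> \<open>The exponent collects the halves (a + j)/2 that \<open>one_minus\<close>
    produces for j < n.\<close>
  have P: "qpoch (q powr a) q n = q powr (real n * (real n - 1) / 4 + a * real n / 2) * P a n" for a n
  proof (induction n)
    case (Suc n)
    have "qpoch (q powr a) q (Suc n) = qpoch (q powr a) q n * (1 - q powr (a + real n))"
      using q by (simp add: qpoch_def powr_add powr_realpow mult_ac)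
    also have "\<dots> = q powr (real n * (real n - 1) / 4 + a * real n / 2 + (a + real n) / 2) * P a (Suc n)"
      unfolding Suc one_minus P_Suc by (simp add: powr_add)
    also have "real n * (real n - 1) / 4 + a * real n / 2 + (a + real n) / 2 =
        real (Suc n) * (real (Suc n) - 1) / 4 + a * real (Suc n) / 2"
      by (simp add: field_simps)
    finally show ?case .
  qed (use q in \<open>simp add: qpoch_def P_def\<close>)
  have H: "qpoch (q powr a) (q powr (1/2)) n = q powr (real n * (real n - 1) / 8 + a * real n / 2) * H a n" for a n
  proof (induction n)
    case (Suc n)
    have "(q powr (1/2)) ^ n = q powr (real n / 2)"
      using q by (simp add: powr_powr powr_realpow[symmetric])
    hence "qpoch (q powr a) (q powr (1/2)) (Suc n) = qpoch (q powr a) (q powr (1/2)) n * (1 - q powr (a + real n / 2))"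
      by (simp add: qpoch_def powr_add mult_ac)
    also have "\<dots> = q powr (real n * (real n - 1) / 8 + a * real n / 2 + (a + real n / 2) / 2) * H a (Suc n)"
      unfolding Suc one_minus H_Suc by (simp add: powr_add)
    also have "real n * (real n - 1) / 8 + a * real n / 2 + (a + real n / 2) / 2 =
        real (Suc n) * (real (Suc n) - 1) / 8 + a * real (Suc n) / 2"
      by (simp add: field_simps)
    finally show ?case .
  qed (use q in \<open>simp add: qpoch_def H_def\<close>)
  have q1: "qpoch q q n = qpoch (q powr 1) q n" for n using q by simp
  have lim: "(\<lambda>M. \<Prod>m<M. s (real m + 7/6) * (s (real m + 2/3))\<^sup>2 / ((s (real m + 1))\<^sup>2 * s (real m + 1/2))) \<longlonglongrightarrow> ?L"
  proof -
    have "(\<lambda>M. (qpoch (q powr (2/3)) q M)\<^sup>2 * qpoch (q powr (7/6)) q M / ((qpoch q q M)\<^sup>2 * qpoch (q powr (1/2)) q M)) \<longlonglongrightarrow> ?L"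
      using q qpoch_inf_nonzero[of q 1] qpoch_inf_nonzero[of q "1/2"] by (intro tendsto_intros qpoch_tendsto) auto
    moreover have "(qpoch (q powr (2/3)) q M)\<^sup>2 * qpoch (q powr (7/6)) q M / ((qpoch q q M)\<^sup>2 * qpoch (q powr (1/2)) q M)
        = (\<Prod>m<M. s (real m + 7/6) * (s (real m + 2/3))\<^sup>2 / ((s (real m + 1))\<^sup>2 * s (real m + 1/2)))" for M
    proof -
      define Y where "Y = real M * (real M - 1) / 4"
      define e1 e2 e3 e4 where "e1 = q powr (Y + 2/3 * real M / 2)" and "e2 = q powr (Y + 7/6 * real M / 2)"
        and "e3 = q powr (Y + 1 * real M / 2)" and "e4 = q powr (Y + 1/2 * real M / 2)"
      \<comment> \<open>The powers of q balance because 2 * 2/3 + 7/6 = 2 * 1 + 1/2.\<close>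
      have e: "e1 * e1 * e2 = e3 * e3 * e4"
        unfolding e1_def e2_def e3_def e4_def powr_add[symmetric]
        by (rule arg_cong[where f = "\<lambda>y. q powr y"]) (simp add: field_simps)
      have nz: "e3 \<noteq> 0" "e4 \<noteq> 0" using q by (auto simp: e3_def e4_def)
      have "(e1 * P (2/3) M)\<^sup>2 * (e2 * P (7/6) M) / ((e3 * P 1 M)\<^sup>2 * (e4 * P (1/2) M))
        = (P (2/3) M)\<^sup>2 * P (7/6) M / ((P 1 M)\<^sup>2 * P (1/2) M) * ((e1 * e1 * e2) / (e3 * e3 * e4))"
        by (simp add: power2_eq_square mult_ac)
      also have "\<dots> = (P (2/3) M)\<^sup>2 * P (7/6) M / ((P 1 M)\<^sup>2 * P (1/2) M)"
        unfolding e using nz by simp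
      finally have "(qpoch (q powr (2/3)) q M)\<^sup>2 * qpoch (q powr (7/6)) q M / ((qpoch q q M)\<^sup>2 * qpoch (q powr (1/2)) q M)
        = (P (2/3) M)\<^sup>2 * P (7/6) M / ((P 1 M)\<^sup>2 * P (1/2) M)"
        unfolding q1 P Y_def[symmetric] e1_def e2_def e3_def e4_def .
      also have "\<dots> = (\<Prod>m<M. s (real m + 7/6) * (s (real m + 2/3))\<^sup>2 / ((s (real m + 1))\<^sup>2 * s (real m + 1/2)))"
        by (simp add: P_def prod_dividef prod.distrib prod_power_distrib add_ac mult_ac)
      finally show ?thesis .
    qed
    ultimately show ?thesis by simp
  qed
  have "?t n = (-1) ^ n * ((H (1/6) n)\<^sup>2 * H (5/6) n * (P (-1/3) n * P (5/6) n)) / ((P 1 n)\<^sup>2 * H (1/2) (3 * n))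
     * (1 + s (3/2 * real n) * s (2 * real n - 1/6) / (s (real n / 2 + 1/3) * s (real n - 1/6)))" (is "_ = ?r") for n
  proof -
    define x where "x = real n"
    have 1: "q powr (1/6 - x) * ((1 - q powr (3/2 * x)) * (1 - q powr (2 * x - 1/6)))
                 / ((1 - q powr (x / 2 + 1/3)) * (1 - q powr (x - 1/6))) =
        s (3/2 * x) * s (2 * x - 1/6) / (s (x / 2 + 1/3) * s (x - 1/6))"
    proof -
      define f0 f1 f2 f3 f4 where "f0 = q powr (1/6 - x)" and "f1 = q powr (3/2 * x / 2)"
        and "f2 = q powr ((2 * x - 1/6) / 2)" and "f3 = q powr ((x / 2 + 1/3) / 2)" and "f4 = q powr ((x - 1/6) / 2)"
      have f: "f0 * f1 * f2 = f3 * f4"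
        unfolding f0_def f1_def f2_def f3_def f4_def powr_add[symmetric]
        by (rule arg_cong[where f = "\<lambda>y. q powr y"]) (simp add: field_simps)
      have f_nz: "f3 \<noteq> 0" "f4 \<noteq> 0" using q by (auto simp: f3_def f4_def)
      have "f0 * ((f1 * s (3/2 * x)) * (f2 * s (2 * x - 1/6))) / ((f3 * s (x / 2 + 1/3)) * (f4 * s (x - 1/6))) =
        s (3/2 * x) * s (2 * x - 1/6) / (s (x / 2 + 1/3) * s (x - 1/6)) * ((f0 * f1 * f2) / (f3 * f4))"
        by (simp add: mult_ac)
      thus ?thesis
        unfolding one_minus f using f_nz unfolding f0_def f1_def f2_def f3_def f4_def by simp
    qed
    define e1 e2 e3 e4 e5 e6 where
      "e1 = q powr (x * (x - 1) / 8 + 1/6 * x / 2)" and "e2 = q powr (x * (x - 1) / 8 + 5/6 * x / 2)" and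
      "e3 = q powr (x * (x - 1) / 4 + -1/3 * x / 2)" and "e4 = q powr (x * (x - 1) / 4 + 5/6 * x / 2)" and
      "e5 = q powr (x * (x - 1) / 4 + 1 * x / 2)" and "e6 = q powr (3 * x * (3 * x - 1) / 8 + 1/2 * (3 * x) / 2)"
    \<comment> \<open>The displayed power of q is exactly the one that removes all powers of q from
      the coefficient.\<close>
    have e: "e1 * e1 * e2 * (e3 * e4) * q powr (x * (9 * x + 11) / 12) = e5 * e5 * e6"
      unfolding e1_def e2_def e3_def e4_def e5_def e6_def powr_add[symmetric]
      by (rule arg_cong[where f = "\<lambda>y. q powr y"]) (simp add: field_simps)
    have nz': "e5 \<noteq> 0" "e6 \<noteq> 0" "P 1 n \<noteq> 0" "H (1/2) (3 * n) \<noteq> 0"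
      using q P_pos[of 1 n] H_pos[of "1/2" "3 * n"] by (auto simp: e5_def e6_def)
    have 3: "real (3 * n) = 3 * x" by (simp add: x_def)
    have "(-1) ^ n * ((e1 * H (1/6) n)\<^sup>2 * (e2 * H (5/6) n) * ((e3 * P (-1/3) n) * (e4 * P (5/6) n)))
        / ((e5 * P 1 n)\<^sup>2 * (e6 * H (1/2) (3 * n))) * q powr (x * (9 * x + 11) / 12)
       = (-1) ^ n * ((H (1/6) n)\<^sup>2 * H (5/6) n * (P (-1/3) n * P (5/6) n)) / ((P 1 n)\<^sup>2 * H (1/2) (3 * n))
        * ((e1 * e1 * e2 * (e3 * e4) * q powr (x * (9 * x + 11) / 12)) / (e5 * e5 * e6))"
      by (simp add: power2_eq_square mult_ac)
    also have "\<dots> = (-1) ^ n * ((H (1/6) n)\<^sup>2 * H (5/6) n * (P (-1/3) n * P (5/6) n)) / ((P 1 n)\<^sup>2 * H (1/2) (3 * n))"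
      unfolding e using nz' by simp
    finally show ?thesis
      unfolding q1 P H 3 x_def[symmetric] 1
      unfolding e1_def[symmetric] e2_def[symmetric] e3_def[symmetric] e4_def[symmetric] e5_def[symmetric] e6_def[symmetric]
      by (simp only:)
  qed
  thus ?thesis using accelerated_sum[OF lim] by (simp only:)
qed

section \<open>Gamma values and the classical series\<close>

lemma Gamma_reflection_third: "Gamma (1/3) * Gamma (2/3) = 2 * pi / sqrt (3 :: real)"
proof -
  have "complex_of_real (Gamma (1/3) * Gamma (2/3)) = Gamma (of_real (1/3)) * Gamma (1 - of_real (1/3))"
    unfolding of_real_mult by (simp add: Gamma_complex_of_real[symmetric])
  also have "\<dots> = of_real (pi / sin (pi / 3))"
    unfolding Gamma_reflection_complex by (simp add: sin_of_real[symmetric])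
  finally have "Gamma (1/3) * Gamma (2/3) = pi / sin (pi / 3)"
    by (simp only: of_real_eq_iff)
  thus ?thesis by (simp add: sin_60)
qed

text \<open>Legendre duplication at z = 1/6; the cube root of 4 is 2^(1 - 2z).\<close>

lemma Gamma_duplication_sixth: "Gamma (1/6) * Gamma (2/3) = root 3 4 * sqrt pi * Gamma (1/3 :: real)"
proof -
  have "complex_of_real (1/6) \<notin> \<int>\<^sub>\<le>\<^sub>0" "complex_of_real (1/6) + 1/2 \<notin> \<int>\<^sub>\<le>\<^sub>0"
    by (auto elim!: nonpos_Ints_cases simp: complex_eq_iff)
  from Gamma_legendre_duplication[OF this]
  have "Gamma (complex_of_real (1/6)) * Gamma (complex_of_real (2/3)) =
      exp (complex_of_real (2/3 * ln 2)) * of_real (sqrt pi) * Gamma (complex_of_real (1/3))"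
    by simp
  hence "complex_of_real (Gamma (1/6) * Gamma (2/3)) = of_real (exp (2/3 * ln 2) * sqrt pi * Gamma (1/3))"
    by (simp only: Gamma_complex_of_real exp_of_real[symmetric] of_real_mult)
  hence "Gamma (1/6) * Gamma (2/3) = exp (2/3 * ln 2) * sqrt pi * Gamma (1/3 :: real)"
    by (simp only: of_real_eq_iff)
  moreover have "root 3 4 = exp (2/3 * ln 2)"
    using ln_realpow[of 2 2] by (simp add: root_powr_inverse powr_def)
  ultimately show ?thesis by simp
qed

text \<open>Duplication trades Gamma (1/6) for Gamma (1/3), which reflection then removes together
  with the remaining Gamma (2/3).\<close>

lemma Gamma_value: "Gamma 1 ^ 2 * Gamma (1/2) / (Gamma (7/6) * Gamma (2/3 :: real) ^ 2) = 3 * sqrt 3 / (pi * root 3 4)"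
proof -
  have "(1/6 :: real) \<notin> \<int>\<^sub>\<le>\<^sub>0"
    using nonpos_Ints_nonpos[of "1/6 :: real"] by auto
  from Gamma_plus1[OF this] have "Gamma (7/6 :: real) = Gamma (1/6) / 6"
    by simp
  hence "Gamma (7/6) * Gamma (2/3 :: real) ^ 2 = Gamma (1/6) * Gamma (2/3) * Gamma (2/3) / 6"
    by (simp add: power2_eq_square)
  also have "\<dots> = root 3 4 * sqrt pi * (Gamma (1/3) * Gamma (2/3)) / 6"
    unfolding Gamma_duplication_sixth by simp
  also have "\<dots> = root 3 4 * sqrt pi * pi / (3 * sqrt 3)"
    unfolding Gamma_reflection_third by simp
  finally show ?thesis
    by (simp add: Gamma_one_half_real)
qed
lemma classical_series:
  "(\<lambda>n::nat.
          (-1/27 :: real) ^ n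
          * (pochhammer (1/3) n * pochhammer (-1/3) n * pochhammer (-1/6) n)
          / (pochhammer 1 n) ^ 3
          * (1 - 63 * (real n)\<^sup>2))
      sums (3 * sqrt 3 / (pi * root 3 4))" (is "?t sums ?L")
proof -
  define s where "s = (\<lambda>x::real. x)"
  interpret bracket s 1
    unfolding s_def by (rule bracket_id)
  have P: "P x n = pochhammer x n" for x n
    unfolding P_def by (simp add: s_def pochhammer_prod atLeast0LessThan)
  have lim: "(\<lambda>M. \<Prod>m<M. s (real m + 7/6) * (s (real m + 2/3))\<^sup>2 / ((s (real m + 1))\<^sup>2 * s (real m + 1/2))) \<longlonglongrightarrow> ?L"
  proof -
    let ?g = "Gamma_series' :: real \<Rightarrow> _"
    have pos: "Gamma (7/6 :: real) \<noteq> 0" "Gamma (2/3 :: real) \<noteq> 0"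
      using Gamma_real_pos[of "7/6"] Gamma_real_pos[of "2/3"] by linarith+
    have "(\<lambda>M. ?g 1 M ^ 2 * ?g (1/2) M / (?g (7/6) M * ?g (2/3) M ^ 2)) \<longlonglongrightarrow> Gamma 1 ^ 2 * Gamma (1/2) / (Gamma (7/6) * Gamma (2/3) ^ 2)"
      by (intro tendsto_intros Gamma_series'_LIMSEQ) (use pos in auto)
    moreover have "eventually (\<lambda>M. ?g 1 M ^ 2 * ?g (1/2) M / (?g (7/6) M * ?g (2/3) M ^ 2) =
       (\<Prod>m<M. s (real m + 7/6) * (s (real m + 2/3))\<^sup>2 / ((s (real m + 1))\<^sup>2 * s (real m + 1/2)))) sequentially"
      using eventually_gt_at_top[of 0]
    proof eventually_elim
      case (elim M)
      define l where "l = ln (real M)"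
      \<comment> \<open>Since 2 * 1 + 1/2 = 7/6 + 2 * 2/3, the powers of M in the Gamma limits
        cancel.\<close>
      have "exp (1 * l) ^ 2 * exp (1/2 * l) = exp (7/6 * l) * exp (2/3 * l) ^ 2"
        by (simp add: power2_eq_square exp_add[symmetric])
      hence "?g 1 M ^ 2 * ?g (1/2) M / (?g (7/6) M * ?g (2/3) M ^ 2) =
          pochhammer (7/6) M * pochhammer (2/3) M ^ 2 / (pochhammer 1 M ^ 2 * pochhammer (1/2) M)"
        using pochhammer_pos[of "7/6 :: real" M] pochhammer_pos[of "2/3 :: real" M]
          pochhammer_pos[of "1 :: real" M] pochhammer_pos[of "1/2 :: real" M]
        unfolding Gamma_series'_def l_def[symmetric] of_real_eq_id id_apply
        by (simp add: divide_simps power_divide power_mult_distrib)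
      also have "\<dots> = (\<Prod>m<M. s (real m + 7/6) * (s (real m + 2/3))\<^sup>2 / ((s (real m + 1))\<^sup>2 * s (real m + 1/2)))"
        unfolding P[symmetric] by (simp add: P_def prod_dividef prod.distrib prod_power_distrib add_ac mult_ac)
      finally show ?case .
    qed
    ultimately show ?thesis
      unfolding Gamma_value by (rule Lim_transform_eventually)
  qed
  let ?b = "\<lambda>n::nat. (-1/27 :: real) ^ n * (pochhammer (1/3) n * pochhammer (-1/3) n * pochhammer (-1/6) n) / (pochhammer 1 n) ^ 3"
  let ?E = "\<lambda>n. (-1) ^ n * ((H (1/6) n)\<^sup>2 * H (5/6) n * (P (-1/3) n * P (5/6) n)) / ((P 1 n)\<^sup>2 * H (1/2) (3 * n))"
  \<comment> \<open>The linear factors come from (5/3)_n = (1 + 3n/2) (2/3)_n and (5/6)_n = (1 - 6n)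
    (-1/6)_n. The power of 27 comes from splitting the factorial of length 3n into three of length
    n.\<close>
  have E: "?E n = ?b n * ((1 + 3/2 * real n) * (1 - 6 * real n))" for n
  proof (induction n)
    case (Suc n)
    define x where "x = real n"
    have x: "0 \<le> x" by (simp add: x_def)
    have 3: "3 * Suc n = Suc (Suc (Suc (3 * n)))" by simp
    have "?E (Suc n) = ?E n * (- ((1/6 + x/2)\<^sup>2 * (5/6 + x/2) * (-1/3 + x) * (5/6 + x)) /
        ((1 + x)\<^sup>2 * ((1/2 + 3 * x / 2) * (1/2 + (3 * x + 1) / 2) * (1/2 + (3 * x + 2) / 2))))"
      unfolding 3 H_Suc P_Suc by (simp add: s_def x_def power2_eq_square mult_ac add_ac)
    also have "\<dots> = ?b n * (((1 + 3/2 * x) * (1 - 6 * x)) * (- ((1/6 + x/2)\<^sup>2 * (5/6 + x/2) * (-1/3 + x) * (5/6 + x)) /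
        ((1 + x)\<^sup>2 * ((1/2 + 3 * x / 2) * (1/2 + (3 * x + 1) / 2) * (1/2 + (3 * x + 2) / 2)))))"
      unfolding Suc x_def by (simp only: mult.assoc)
    also have "((1 + 3/2 * x) * (1 - 6 * x)) * (- ((1/6 + x/2)\<^sup>2 * (5/6 + x/2) * (-1/3 + x) * (5/6 + x)) /
        ((1 + x)\<^sup>2 * ((1/2 + 3 * x / 2) * (1/2 + (3 * x + 1) / 2) * (1/2 + (3 * x + 2) / 2)))) =
        (-1/27) * ((1/3 + x) * (-1/3 + x) * (-1/6 + x)) / (1 + x) ^ 3 * ((1 + 3/2 * (x + 1)) * (1 - 6 * (x + 1)))"
    proof -
      have nz: "3 * x + 1 \<noteq> 0" "3 * x + 2 \<noteq> 0" "1 + x \<noteq> 0" using x by auto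
      \<comment> \<open>Treating the linear forms in x as independent variables reduces the claim to
        plain cancellation.\<close>
      have *: "v / 2 * E * (- ((u / 6)\<^sup>2 * (A / 6) * (B / 3) * (D / 6)) / (w\<^sup>2 * (u / 2 * (v / 2) * (3 * w / 2))))
          = - 1/27 * (u / 3 * (B / 3) * (- E / 6)) / w ^ 3 * (A / 2 * - D)"
        if "u \<noteq> 0" "v \<noteq> 0" "w \<noteq> 0" for u v w A B D E :: real
        using that by (simp add: power2_eq_square power3_eq_cube)
      have e: "1 + 3/2 * x = (3 * x + 2) / 2" "1/2 + 3 * x / 2 = (3 * x + 1) / 2" "1/2 + (3 * x + 1) / 2 = (3 * x + 2) / 2"
        "1/2 + (3 * x + 2) / 2 = 3 * (1 + x) / 2" "5/6 + x / 2 = (3 * x + 5) / 6" "1/6 + x / 2 = (3 * x + 1) / 6"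
        "- 1/3 + x = (3 * x - 1) / 3" "5/6 + x = (6 * x + 5) / 6" "1/3 + x = (3 * x + 1) / 3" "- 1/6 + x = - (1 - 6 * x) / 6"
        "1 + 3/2 * (x + 1) = (3 * x + 5) / 2" "1 - 6 * (x + 1) = - (6 * x + 5)"
        by (auto simp: field_simps)
      show ?thesis unfolding e using nz by (rule *)
    qed
    also have "?b n * \<dots> = ?b (Suc n) * ((1 + 3/2 * real (Suc n)) * (1 - 6 * real (Suc n)))"
      by (simp add: pochhammer_Suc x_def power_mult_distrib mult_ac add_ac)
    finally show ?case .
  qed (simp add: H_def P_def)
  have "?E n * (1 + s (3/2 * real n) * s (2 * real n - 1/6) / (s (real n / 2 + 1/3) * s (real n - 1/6))) = ?t n" for n
  proof -
    define x where "x = real n"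
    have "x = 0 \<or> 1 \<le> x"
      unfolding x_def by (cases n) auto
    hence x: "x / 2 + 1/3 \<noteq> 0" "x - 1/6 \<noteq> 0"
      by auto
    \<comment> \<open>The prefactor is -18 times the denominator, so the sum is (1 - 9x/2 - 9x^2) +
      (9x/2 - 54x^2).\<close>
    have "(1 + 3/2 * x) * (1 - 6 * x) * (1 + 3/2 * x * (2 * x - 1/6) / ((x / 2 + 1/3) * (x - 1/6))) = 1 - 63 * x\<^sup>2"
      using x by (simp add: divide_simps) algebra
    thus ?thesis unfolding E by (simp add: s_def x_def mult.assoc)
  qed
  thus ?thesis using accelerated_sum[OF lim] by (simp only:)
qed

theorem mainTheorem12:
  shows "(\<forall>q::real. 0 < q \<and> q < 1 \<longrightarrow>
      (\<lambda>n::nat.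
          (-1) ^ n
          * ((qpoch (q powr (1/6)) (q powr (1/2)) n)\<^sup>2
              * qpoch (q powr (5/6)) (q powr (1/2)) n
              * (qpoch (q powr (-1/3)) q n * qpoch (q powr (5/6)) q n))
          / ((qpoch q q n)\<^sup>2 * qpoch (q powr (1/2)) (q powr (1/2)) (3 * n))
          * q powr (real n * (9 * real n + 11) / 12)
          * (1 + q powr (1/6 - real n)
                 * ((1 - q powr (3/2 * real n)) * (1 - q powr (2 * real n - 1/6)))
                 / ((1 - q powr (real n / 2 + 1/3)) * (1 - q powr (real n - 1/6)))))
      sums
        ((qpoch_inf (q powr (2/3)) q)\<^sup>2 * qpoch_inf (q powr (7/6)) q
          / ((qpoch_inf q q)\<^sup>2 * qpoch_inf (q powr (1/2)) q)))
    \<and>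
      (\<lambda>n::nat.
          (-1/27 :: real) ^ n
          * (pochhammer (1/3) n * pochhammer (-1/3) n * pochhammer (-1/6) n)
          / (pochhammer 1 n) ^ 3
          * (1 - 63 * (real n)\<^sup>2))
      sums (3 * sqrt 3 / (pi * root 3 4))"
  using q_series classical_series by blast

end
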